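(* Let $C = \frac{11+5\sqrt 5}{2} \le 11.091$. There is a complete set of representations for $n$ with $\mathcal{O}\bigl(n!\cdot \frac{C^n}{n^6}\bigr)$ elements; that is, there is a constant $K>0$ such that for every integer $n\ge 1$ there exists a complete set of representations for $n$ with at most $K\cdot n!\cdot \frac{C^n}{n^6}$ elements.
   Context: Let $n\ge 1$ be an integer and $[n]=\{1,\ldots,n\}$. A placement of size $n$ is a tuple $P=(x_{\min},y_{\min},x_{\max},y_{\max})$ of functions $[n]\to\mathbb{R}$ with $x_{\min}(i)<x_{\max}(i)$ and $y_{\min}(i)<y_{\max}(i)$ for all $i\in[n]$. For $i\neq j$ in $[n]$ we say (in $P$): $i$ is west of $j$ if $x_{\max}(i)\le x_{\min}(j)$; $i$ is south of $j$ if $y_{\max}(i)\le y_{\min}(j)$; $i$ is east of $j$ if $x_{\max}(j)\le x_{\min}(i)$; $i$ is north of $j$ if $y_{\max}(j)\le y_{\min}(i)$. $P$ is feasible if for all $i\ne j$ at least one of these four spatial relations holds for $(i,j)$. A function $r:[n]^2\setminus\{(i,i):i\in[n]\}\to\{\text{west},\text{south},\text{east},\text{north}\}$ represents (is a representation of) a feasible placement $P$ if for all $i\neq j$ the spatial relation $r(i,j)$ holds for $(i,j)$ in $P$ (e.g. $r(i,j)=\text{west}$ implies $i$ is west of $j$). A complete set of representations for $n$ is a set $R$ of such functions such that for every feasible placement $P$ of size $n$ there is an element of $R$ that represents $P$. *)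

theory Defs
  imports Complex_Main "HOL-Library.FuncSet"
begin

datatype direction = West | South | East | North

text \<open>The coordinate functions are total; everything below uses only their values on
  \<open>{1..n}\<close>, where \<open>n\<close> is the size of the placement.\<close>

record placement =
  xmin :: "nat \<Rightarrow> real"
  ymin :: "nat \<Rightarrow> real"
  xmax :: "nat \<Rightarrow> real"
  ymax :: "nat \<Rightarrow> real"

definition is_placement :: "nat \<Rightarrow> placement \<Rightarrow> bool" where
  "is_placement n P \<longleftrightarrow> (\<forall>i\<in>{1..n}. xmin P i < xmax P i \<and> ymin P i < ymax P i)"

fun spatial_rel :: "placement \<Rightarrow> direction \<Rightarrow> nat \<Rightarrow> nat \<Rightarrow> bool" where
  "spatial_rel P West i j \<longleftrightarrow> xmax P i \<le> xmin P j"
| "spatial_rel P South i j \<longleftrightarrow> ymax P i \<le> ymin P j"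
| "spatial_rel P East i j \<longleftrightarrow> xmax P j \<le> xmin P i"
| "spatial_rel P North i j \<longleftrightarrow> ymax P j \<le> ymin P i"

definition off_diagonal :: "nat \<Rightarrow> (nat \<times> nat) set" where
  "off_diagonal n = {1..n} \<times> {1..n} - {(i, i) | i. i \<in> {1..n}}"

definition feasible :: "nat \<Rightarrow> placement \<Rightarrow> bool" where
  "feasible n P \<longleftrightarrow> is_placement n P \<and> (\<forall>(i, j)\<in>off_diagonal n. \<exists>d. spatial_rel P d i j)"

text \<open>Extensional functions, so that two elements of this set are equal exactly if they agree on
  \<open>off_diagonal n\<close>, and cardinalities count functions with domain \<open>off_diagonal n\<close>.\<close>

definition direction_maps :: "nat \<Rightarrow> (nat \<times> nat \<Rightarrow> direction) set" where
  "direction_maps n = off_diagonal n \<rightarrow>\<^sub>E UNIV"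

definition represents :: "nat \<Rightarrow> (nat \<times> nat \<Rightarrow> direction) \<Rightarrow> placement \<Rightarrow> bool" where
  "represents n r P \<longleftrightarrow> (\<forall>(i, j)\<in>off_diagonal n. spatial_rel P (r (i, j)) i j)"

definition complete_representations :: "nat \<Rightarrow> (nat \<times> nat \<Rightarrow> direction) set \<Rightarrow> bool" where
  "complete_representations n R \<longleftrightarrow>
     R \<subseteq> direction_maps n \<and> (\<forall>P. feasible n P \<longrightarrow> (\<exists>r\<in>R. represents n r P))"

text \<open>Finiteness is automatic, so \<open>card\<close> is the true number of elements.\<close>

lemma finite_complete_representations:
  assumes "complete_representations n R"
  shows "finite R"
proof -
  have "(UNIV :: direction set) = {West, South, East, North}"
    using direction.exhaust by auto
  then have "finite (UNIV :: direction set)"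
    by (metis finite.emptyI finite.insertI)
  then have "finite (direction_maps n)"
    unfolding direction_maps_def off_diagonal_def by (intro finite_PiE) auto
  then show ?thesis
    using assms unfolding complete_representations_def by (blast intro: finite_subset)
qed

end

theory Submission
  imports Defs "HOL-Analysis.Analysis" "HOL-Combinatorics.Multiset_Permutations"
begin

text \<open>
  A placement is represented by a pair of orders of the rectangles: in the first, each rectangle is
  west or north of every later one; in the second, west or south. Both orders can be chosen greedily
  so that consecutive elements are never swapped needlessly, and then the permutation comparing them
  avoids the pattern 2-14-3. It remains to count these permutations (called plane). Inserting a new
  last value makes them the nodes of a generating tree with labels \<open>(h, k)\<close> and children
  \<open>(i, k + 1)\<close> for \<open>1 \<le> i \<le> h\<close> and \<open>(h + k + 1 - j, j)\<close> for \<open>1 \<le> j \<le> k\<close>.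

  On exponentials \<open>\<alpha>\<^sup>h \<beta>\<^sup>k\<close> this rule acts by a factor \<open>\<lambda>\<close> up to two boundary terms. In the
  coordinates \<open>\<alpha> = 1 + 1 / u\<^sub>1\<close>, \<open>\<beta> = 1 + u\<^sub>3\<close>, where \<open>u\<^sub>1, \<dots>, u\<^sub>5\<close> satisfy the pentagon recurrence
  \<open>u\<^bsub>i-1\<^esub> u\<^bsub>i+1\<^esub> = 1 + u\<^sub>i\<close>, one has \<open>\<lambda> = u\<^sub>1 u\<^sub>2 u\<^sub>3 u\<^sub>4 u\<^sub>5\<close>. Constant terms of Laurent polynomials in the
  \<open>u\<^sub>i\<close>, computed as integrals over a torus, are invariant under the dihedral group of the pentagon, so
  the boundary terms vanish when the integrand carries the antisymmetric factor
  \<open>Y = \<Prod>(u\<^sub>i - u\<^bsub>i+1\<^esub>)\<close>. Antisymmetrising once more bounds the number of plane permutations by a multiple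
  of the integral of \<open>\<lambda>\<^sup>n Y\<^sup>2\<close>. On the torus with both radii the golden ratio \<open>\<phi>\<close>, the modulus of \<open>\<lambda>\<close> is
  at most \<open>C = \<phi>\<^sup>5\<close> with a Gaussian drop-off, and \<open>Y\<^sup>2\<close> vanishes to order ten at the maximum, whence
  \<open>C\<^sup>n n\<^sup>-\<^sup>1\<^sup>-\<^sup>5\<close>.
\<close>

subsection \<open>The generating tree of plane permutations\<close>

definition plane :: "nat list \<Rightarrow> bool" where
  "plane w \<longleftrightarrow> \<not> (\<exists>i j k. i < j \<and> Suc j < k \<and> k < length w \<and>
     w ! j < w ! i \<and> w ! i < w ! k \<and> w ! k < w ! Suc j)"

definition plane_perms :: "nat \<Rightarrow> nat list set" where
  "plane_perms n = {w. distinct w \<and> set w = {..<n} \<and> plane w}"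

text \<open>The values that can be appended to \<open>w\<close>, shifting the larger entries, without creating a 2-14-3.\<close>

definition active :: "nat list \<Rightarrow> nat set" where
  "active w = {a. a \<le> length w \<and> \<not> (\<exists>i j. i < j \<and> Suc j < length w \<and>
     w ! j < w ! i \<and> w ! i < a \<and> a \<le> w ! Suc j)}"

definition shift :: "nat \<Rightarrow> nat \<Rightarrow> nat" where
  "shift a y = (if y < a then y else Suc y)"

definition child :: "nat list \<Rightarrow> nat \<Rightarrow> nat list" where
  "child w a = map (shift a) w @ [a]"

text \<open>The node label \<open>(h, k)\<close> of \<open>w\<close> is
  \<open>(above w, below w)\<close>; the sites on the two sides of the last entry lead to the two
  kinds of children.\<close>

definition above :: "nat list \<Rightarrow> nat" where
  "above w = card {a \<in> active w. last w < a}"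

definition below :: "nat list \<Rightarrow> nat" where
  "below w = card {a \<in> active w. a \<le> last w}"

definition succ_rule :: "(nat \<Rightarrow> nat \<Rightarrow> real) \<Rightarrow> nat \<Rightarrow> nat \<Rightarrow> real" where
  "succ_rule f h k = (\<Sum>i = 1..h. f i (Suc k)) + (\<Sum>j = 1..k. f (Suc (h + k) - j) j)"

lemma plane_perms_length: "w \<in> plane_perms n \<Longrightarrow> length w = n"
  unfolding plane_perms_def using distinct_card by force

lemma finite_plane_perms: "finite (plane_perms n)"
proof (rule finite_subset)
  show "plane_perms n \<subseteq> {w. set w \<subseteq> {..<n} \<and> length w = n}"
    by (auto simp: plane_perms_length) (simp add: plane_perms_def)
qed (simp add: finite_lists_length_eq)

lemma finite_active [simp]: "finite (active w)"
  by (rule finite_subset[of _ "{..length w}"]) (auto simp: active_def)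

lemma shift_less_iff [simp]: "shift a x < shift a y \<longleftrightarrow> x < y"
  by (auto simp: shift_def)

lemma length_child [simp]: "length (child w a) = Suc (length w)"
  by (simp add: child_def)

lemma last_child [simp]: "last (child w a) = a"
  by (simp add: child_def)

lemma nth_child: "i < length w \<Longrightarrow> child w a ! i = shift a (w ! i)"
  by (simp add: child_def nth_append)

lemma nth_child_last: "child w a ! length w = a"
  by (simp add: child_def nth_append)

lemma plane_childD:
  assumes "plane (child w a)"
  shows "plane w"
  unfolding plane_def
proof (intro notI, elim exE conjE)
  fix i j k
  assume *: "i < j" "Suc j < k" "k < length w" "w ! j < w ! i" "w ! i < w ! k" "w ! k < w ! Suc j"
  then have "i < j \<and> Suc j < k \<and> k < length (child w a) \<and> child w a ! j < child w a ! i \<and>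
      child w a ! i < child w a ! k \<and> child w a ! k < child w a ! Suc j"
    by (simp add: nth_child)
  with assms show False unfolding plane_def by blast
qed

lemma active_of_plane_child:
  assumes "plane (child w a)" "a \<le> length w"
  shows "a \<in> active w"
  unfolding active_def
proof (intro CollectI conjI notI assms(2), elim exE conjE)
  fix i j
  assume *: "i < j" "Suc j < length w" "w ! j < w ! i" "w ! i < a" "a \<le> w ! Suc j"
  then have "i < j \<and> Suc j < length w \<and> length w < length (child w a) \<and> child w a ! j < child w a ! i \<and>
      child w a ! i < child w a ! length w \<and> child w a ! length w < child w a ! Suc j"
    by (simp add: nth_child nth_child_last) (simp add: shift_def)
  with assms show False unfolding plane_def by blast
qed

text \<open>Deleting the last entry and closing the gap keeps a permutation plane, and the deleted
  value is an active site of the result. An inclusion suffices for an upper bound on the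
  count.\<close>

lemma plane_perms_Suc_subset:
  "plane_perms (Suc n) \<subseteq> (\<lambda>(w, a). child w a) ` (SIGMA w:plane_perms n. active w)"
proof
  fix w' assume w': "w' \<in> plane_perms (Suc n)"
  then have len: "length w' = Suc n" by (rule plane_perms_length)
  from w' have dist: "distinct w'" and set: "set w' = {..<Suc n}" and pl: "plane w'"
    by (auto simp: plane_perms_def)
  define a where "a = last w'"
  define v where "v = butlast w'"
  have w'_eq: "w' = v @ [a]"
    using len unfolding a_def v_def by (intro append_butlast_last_id[symmetric]) auto
  have dv: "distinct v" "a \<notin> set v" and sv: "insert a (set v) = {..<Suc n}"
    using dist set unfolding w'_eq by (simp_all del: lessThan_Suc)
  have a_le: "a \<le> n"
  proof -
    have "a \<in> {..<Suc n}" unfolding sv[symmetric] by simp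
    then show ?thesis by simp
  qed
  define un where "un = (\<lambda>y. if a < y then y - 1 else y)"
  define w where "w = map un v"
  have shift_un: "shift a (un y) = y" if "y \<in> set v" for y
    using that dv by (auto simp: un_def shift_def)
  have ch: "w' = child w a"
    using shift_un by (simp add: w'_eq child_def w_def comp_def map_idI)
  have inj: "inj_on un (set v)" by (metis inj_onI shift_un)
  have "distinct w" using dv inj by (simp add: w_def distinct_map)
  moreover have "set w = {..<n}"
  proof (rule card_subset_eq)
    have "card (set v) = n" using dv distinct_card[of v] len w'_eq by simp
    then show "card (set w) = card {..<n}" using inj by (simp add: w_def card_image)
    show "set w \<subseteq> {..<n}"
    proof
      fix z assume "z \<in> set w"
      then obtain y where y: "y \<in> set v" "z = un y" by (auto simp: w_def)
      then have "y \<in> {..<Suc n}" "y \<noteq> a" using dv unfolding sv[symmetric] by auto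
      then show "z \<in> {..<n}" using y a_le by (auto simp: un_def)
    qed
  qed simp
  moreover have "plane w" by (rule plane_childD[of _ a]) (use pl ch in simp)
  ultimately have "w \<in> plane_perms n" by (simp add: plane_perms_def)
  moreover have "a \<in> active w"
    by (rule active_of_plane_child) (use pl ch a_le plane_perms_length[OF calculation] in auto)
  ultimately show "w' \<in> (\<lambda>(w, a). child w a) ` (SIGMA w:plane_perms n. active w)"
    by (intro image_eqI[of _ _ "(w, a)"]) (simp_all add: ch)
qed

section \<open>Active sites after one insertion\<close>

lemma ex_split: "(\<exists>i j. P i j) \<longleftrightarrow> (\<exists>i. P i m) \<or> (\<exists>i j. j \<noteq> m \<and> P i j)"
  by metis

text \<open>The only new adjacent pair is the old last entry followed by \<open>a\<close>. It blocks
  a site \<open>b <= a\<close> exactly when some entry lies strictly between \<open>last w\<close>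
  and \<open>b\<close>. If \<open>a > last w\<close> and \<open>b > Suc (last w)\<close>, the value
  \<open>Suc (last w)\<close> is such an entry.\<close>

lemma active_child_low:
  assumes w: "w \<in> plane_perms n" "w \<noteq> []" and b: "b \<le> a" "a \<le> length w"
  shows "b \<in> active (child w a) \<longleftrightarrow> b \<in> active w \<and> (a \<le> last w \<or> b \<le> Suc (last w))"
proof -
  define m where "m = length w - 1"
  have len: "length w = Suc m" using w(2) by (cases w) (auto simp: m_def)
  have last: "last w = w ! m" using w(2) by (simp add: last_conv_nth m_def)
  have setw: "set w = {..<Suc m}"
    using w plane_perms_length[OF w(1)] len by (simp add: plane_perms_def)
  have low: "shift a y < b \<longleftrightarrow> y < b" "b \<le> shift a y \<longleftrightarrow> b \<le> y" for y
    using b by (auto simp: shift_def)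
  let ?P = "\<lambda>i j. i < j \<and> Suc j < Suc (length w) \<and> child w a ! j < child w a ! i \<and>
     child w a ! i < b \<and> b \<le> child w a ! Suc j"
  have old: "?P i j \<longleftrightarrow> i < j \<and> Suc j < length w \<and> w ! j < w ! i \<and> w ! i < b \<and> b \<le> w ! Suc j"
    if "j \<noteq> m" for i j
    using that by (cases "Suc j < length w") (auto simp: nth_child low len)
  have new: "?P i m \<longleftrightarrow> i < m \<and> w ! m < w ! i \<and> w ! i < b" for i
    using b nth_child_last[of w a] len by (auto simp: nth_child low)
  have "(\<exists>i. ?P i m) \<longleftrightarrow> \<not> (a \<le> last w \<or> b \<le> Suc (last w))"
  proof
    assume "\<exists>i. ?P i m"
    then show "\<not> (a \<le> last w \<or> b \<le> Suc (last w))"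
    proof
      fix i assume "?P i m"
      then have "w ! m < w ! i \<and> w ! i < b" using new by blast
      then show ?thesis using b last by linarith
    qed
  next
    assume *: "\<not> (a \<le> last w \<or> b \<le> Suc (last w))"
    then have "Suc (last w) \<in> set w" using b len by (auto simp: setw)
    then obtain i where i: "i < length w" "w ! i = Suc (last w)" by (auto simp: in_set_conv_nth)
    then have "i \<noteq> m" using last by auto
    then have "i < m \<and> w ! m < w ! i \<and> w ! i < b" using i * len last by auto
    then have "?P i m" using new by blast
    then show "\<exists>i. ?P i m" by blast
  qed
  moreover have "b \<in> active (child w a) \<longleftrightarrow> \<not> (\<exists>i j. ?P i j)"
    using b by (simp add: active_def)
  moreover have "(\<exists>i j. ?P i j) \<longleftrightarrow> (\<exists>i. ?P i m) \<or>
      (\<exists>i j. i < j \<and> Suc j < length w \<and> w ! j < w ! i \<and> w ! i < b \<and> b \<le> w ! Suc j)"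
  proof -
    have "(\<exists>i j. ?P i j) \<longleftrightarrow> (\<exists>i. ?P i m) \<or> (\<exists>i j. j \<noteq> m \<and> ?P i j)"
      by (rule ex_split)
    moreover have "(\<exists>i j. j \<noteq> m \<and> ?P i j) \<longleftrightarrow>
        (\<exists>i j. i < j \<and> Suc j < length w \<and> w ! j < w ! i \<and> w ! i < b \<and> b \<le> w ! Suc j)"
    proof (intro iff_exI)
      fix i j
      show "j \<noteq> m \<and> ?P i j \<longleftrightarrow> i < j \<and> Suc j < length w \<and> w ! j < w ! i \<and> w ! i < b \<and> b \<le> w ! Suc j"
      proof (cases "j = m")
        case True
        then show ?thesis using len by simp
      next
        case False
        then show ?thesis using old[OF False, of i] by blast
      qed
    qed
    ultimately show ?thesis by simp
  qed
  ultimately show ?thesis using b by (auto simp: active_def)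
qed

text \<open>The new adjacent pair ends in \<open>a\<close>, which is below the site
  \<open>Suc b\<close>, so it blocks nothing here; the old obstructions are only shifted.\<close>

lemma active_child_high:
  assumes w: "w \<noteq> []" and b: "a \<le> b"
  shows "Suc b \<in> active (child w a) \<longleftrightarrow> b \<in> active w"
proof -
  define m where "m = length w - 1"
  have len: "length w = Suc m" using w by (cases w) (auto simp: m_def)
  have high: "shift a y < Suc b \<longleftrightarrow> y < b \<or> y < a" "Suc b \<le> shift a y \<longleftrightarrow> b \<le> y" for y
    using b by (auto simp: shift_def)
  let ?P = "\<lambda>i j. i < j \<and> Suc j < Suc (length w) \<and> child w a ! j < child w a ! i \<and>
     child w a ! i < Suc b \<and> Suc b \<le> child w a ! Suc j"
  have "?P i j \<longleftrightarrow> i < j \<and> Suc j < length w \<and> w ! j < w ! i \<and> w ! i < b \<and> b \<le> w ! Suc j" for i j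
  proof (cases "Suc j < length w")
    case True
    then show ?thesis using b by (auto simp: nth_child high)
  next
    case False
    then have "Suc j = length w \<or> \<not> Suc j < Suc (length w)" by linarith
    then show ?thesis using b nth_child_last[of w a] by auto
  qed
  then have "(\<exists>i j. ?P i j) \<longleftrightarrow> (\<exists>i j. i < j \<and> Suc j < length w \<and> w ! j < w ! i \<and> w ! i < b \<and> b \<le> w ! Suc j)"
    by blast
  moreover have "Suc b \<in> active (child w a) \<longleftrightarrow> b \<le> length w \<and> \<not> (\<exists>i j. ?P i j)"
    by (simp only: active_def mem_Collect_eq length_child Suc_le_mono)
  ultimately show ?thesis by (simp only: active_def mem_Collect_eq)
qed

text \<open>A pair blocking this site would form a 2-14-3 in \<open>w\<close> with
  \<open>last w\<close> in the role of 3.\<close>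

lemma Suc_last_active:
  assumes w: "w \<in> plane_perms n" "w \<noteq> []"
  shows "Suc (last w) \<in> active w"
proof -
  define m where "m = length w - 1"
  have len: "length w = Suc m" using w(2) by (cases w) (auto simp: m_def)
  have last: "last w = w ! m" using w(2) by (simp add: last_conv_nth m_def)
  have "last w < length w"
  proof -
    have "set w = {..<n}" using w(1) by (simp add: plane_perms_def)
    then have "last w < n" using last_in_set[OF w(2)] by blast
    then show ?thesis using plane_perms_length[OF w(1)] by simp
  qed
  moreover have False if *: "i < j" "Suc j < length w" "w ! j < w ! i" "w ! i < Suc (last w)"
    "Suc (last w) \<le> w ! Suc j" for i j
  proof -
    have "distinct w" using w(1) by (simp add: plane_perms_def)
    then have "w ! i \<noteq> w ! m" using nth_eq_iff_index_eq[of w i m] *(1,2) len by simp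
    moreover have "Suc j \<noteq> m" using * last by auto
    ultimately have "i < j \<and> Suc j < m \<and> m < length w \<and> w ! j < w ! i \<and> w ! i < w ! m \<and> w ! m < w ! Suc j"
      using * last len by auto
    with w(1) show False unfolding plane_perms_def plane_def by blast
  qed
  ultimately show ?thesis unfolding active_def using Suc_leI by blast
qed

lemma active_child_above:
  assumes "w \<noteq> []"
  shows "above (child w a) = card {b \<in> active w. a \<le> b}"
proof -
  have "{b \<in> active (child w a). a < b} = Suc ` {b \<in> active w. a \<le> b}"
  proof (intro set_eqI iffI)
    fix b assume b: "b \<in> {b \<in> active (child w a). a < b}"
    then obtain c where "b = Suc c" "a \<le> c" by (cases b) auto
    with b active_child_high[OF assms] show "b \<in> Suc ` {b \<in> active w. a \<le> b}" by auto
  qed (use active_child_high[OF assms] in auto)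
  then show ?thesis by (simp add: above_def card_image)
qed

lemma card_Un_active: "card {b \<in> active w. a \<le> b} + card {b \<in> active w. b < a} = card (active w)"
proof -
  have "active w = {b \<in> active w. a \<le> b} \<union> {b \<in> active w. b < a}" by auto
  then show ?thesis by (metis (no_types, lifting) card_Un_disjoint disjoint_iff finite_Un finite_active mem_Collect_eq not_le)
qed

lemma card_active: "card (active w) = above w + below w"
  using card_Un_active[of w "Suc (last w)"] by (simp add: above_def below_def Suc_le_eq less_Suc_eq_le)

text \<open>Here the new entry ends a descent, so no site is lost, and the site \<open>a\<close>
  splits into one on each side of the new entry.\<close>

lemma child_labels_low:
  assumes w: "w \<in> plane_perms n" "w \<noteq> []" and a: "a \<in> active w" "a \<le> last w"
  shows "below (child w a) = card {b \<in> active w. b \<le> a}"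
    "above (child w a) = Suc (above w + below w) - card {b \<in> active w. b \<le> a}"
proof -
  have len: "a \<le> length w" using a by (simp add: active_def)
  show "below (child w a) = card {b \<in> active w. b \<le> a}"
    unfolding below_def using active_child_low[OF w _ len] a
    by (intro arg_cong[where f = card]) auto
  have "{b \<in> active w. b \<le> a} = insert a {b \<in> active w. b < a}" using a by auto
  then have "card {b \<in> active w. b \<le> a} = Suc (card {b \<in> active w. b < a})" by simp
  then show "above (child w a) = Suc (above w + below w) - card {b \<in> active w. b \<le> a}"
    using card_Un_active[of w a] card_active[of w] active_child_above[OF w(2)] by simp
qed

text \<open>The new ascent closes the sites from \<open>last w + 2\<close> up to \<open>a\<close>.
  Below the new entry there remain the \<open>below w\<close> old sites and
  \<open>Suc (last w)\<close>, which is always active.\<close>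

lemma child_labels_high:
  assumes w: "w \<in> plane_perms n" "w \<noteq> []" and a: "a \<in> active w" "last w < a"
  shows "below (child w a) = Suc (below w)"
proof -
  have len: "a \<le> length w" using a by (simp add: active_def)
  have "{b \<in> active (child w a). b \<le> a} = insert (Suc (last w)) {b \<in> active w. b \<le> last w}"
    using active_child_low[OF w _ len] a Suc_last_active[OF w] by auto
  then show ?thesis by (simp add: below_def)
qed

section \<open>Summing over the children by rank\<close>

lemma sum_rank_le:
  fixes A :: "nat set"
  assumes "finite A"
  shows "(\<Sum>a\<in>A. f (card {b \<in> A. b \<le> a})) = (\<Sum>i = 1..card A. f i)"
proof (rule sum.reindex_bij_betw)
  let ?r = "\<lambda>a. card {b \<in> A. b \<le> a}"
  have mono: "?r x < ?r y" if "x \<in> A" "y \<in> A" "x < y" for x y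
  proof (rule psubset_card_mono)
    have "y \<in> {b \<in> A. b \<le> y}" "y \<notin> {b \<in> A. b \<le> x}" using that by auto
    then show "{b \<in> A. b \<le> x} \<subset> {b \<in> A. b \<le> y}" using that by fastforce
  qed (use assms in simp)
  have inj: "inj_on ?r A"
    by (rule linorder_inj_onI') (use mono in fastforce)
  moreover have "?r ` A \<subseteq> {1..card A}"
  proof clarsimp
    fix a assume a: "a \<in> A"
    have "0 < ?r a" using a assms by (subst card_gt_0_iff) auto
    moreover have "?r a \<le> card A" using assms by (intro card_mono) auto
    ultimately show "Suc 0 \<le> ?r a \<and> ?r a \<le> card A" by simp
  qed
  ultimately show "bij_betw ?r A {1..card A}"
    unfolding bij_betw_def by (metis card_atLeastAtMost card_image card_subset_eq diff_Suc_1 finite_atLeastAtMost)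
qed

lemma sum_rank_ge:
  fixes A :: "nat set"
  assumes "finite A"
  shows "(\<Sum>a\<in>A. f (card {b \<in> A. a \<le> b})) = (\<Sum>i = 1..card A. f i)"
proof (rule sum.reindex_bij_betw)
  let ?r = "\<lambda>a. card {b \<in> A. a \<le> b}"
  have mono: "?r y < ?r x" if "x \<in> A" "y \<in> A" "x < y" for x y
  proof (rule psubset_card_mono)
    have "x \<in> {b \<in> A. x \<le> b}" "x \<notin> {b \<in> A. y \<le> b}" using that by auto
    then show "{b \<in> A. y \<le> b} \<subset> {b \<in> A. x \<le> b}" using that by fastforce
  qed (use assms in simp)
  have inj: "inj_on ?r A"
    by (rule linorder_inj_onI') (use mono in fastforce)
  moreover have "?r ` A \<subseteq> {1..card A}"
  proof clarsimp
    fix a assume a: "a \<in> A"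
    have "0 < ?r a" using a assms by (subst card_gt_0_iff) auto
    moreover have "?r a \<le> card A" using assms by (intro card_mono) auto
    ultimately show "Suc 0 \<le> ?r a \<and> ?r a \<le> card A" by simp
  qed
  ultimately show "bij_betw ?r A {1..card A}"
    unfolding bij_betw_def by (metis card_atLeastAtMost card_image card_subset_eq diff_Suc_1 finite_atLeastAtMost)
qed

text \<open>Low sites are indexed by their rank from below, high sites by their rank from above;
  these ranks are the summation indices of the succession rule.\<close>

lemma sum_children:
  assumes w: "w \<in> plane_perms n" "w \<noteq> []"
  shows "(\<Sum>a\<in>active w. f (above (child w a)) (below (child w a))) = succ_rule f (above w) (below w)"
proof -
  let ?L = "{a \<in> active w. a \<le> last w}" and ?H = "{a \<in> active w. last w < a}"
  let ?g = "\<lambda>a. f (above (child w a)) (below (child w a))"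
  have "(\<Sum>a\<in>?L. ?g a) = (\<Sum>a\<in>?L. f (Suc (above w + below w) - card {b \<in> ?L. b \<le> a}) (card {b \<in> ?L. b \<le> a}))"
  proof (rule sum.cong)
    fix a assume a: "a \<in> ?L"
    then have "{b \<in> ?L. b \<le> a} = {b \<in> active w. b \<le> a}" by auto
    then show "?g a = f (Suc (above w + below w) - card {b \<in> ?L. b \<le> a}) (card {b \<in> ?L. b \<le> a})"
      using child_labels_low[OF w] a by simp
  qed simp
  also have "\<dots> = (\<Sum>j = 1..below w. f (Suc (above w + below w) - j) j)"
    unfolding below_def by (rule sum_rank_le) simp
  finally have L: "(\<Sum>a\<in>?L. ?g a) = (\<Sum>j = 1..below w. f (Suc (above w + below w) - j) j)" .
  have "(\<Sum>a\<in>?H. ?g a) = (\<Sum>a\<in>?H. f (card {b \<in> ?H. a \<le> b}) (Suc (below w)))"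
  proof (rule sum.cong)
    fix a assume a: "a \<in> ?H"
    then have "{b \<in> ?H. a \<le> b} = {b \<in> active w. a \<le> b}" by auto
    then show "?g a = f (card {b \<in> ?H. a \<le> b}) (Suc (below w))"
      using child_labels_high[OF w] active_child_above[OF w(2)] a by simp
  qed simp
  also have "\<dots> = (\<Sum>i = 1..above w. f i (Suc (below w)))"
    unfolding above_def by (rule sum_rank_ge) simp
  finally have H: "(\<Sum>a\<in>?H. ?g a) = (\<Sum>i = 1..above w. f i (Suc (below w)))" .
  have "active w = ?H \<union> ?L" by auto
  then have "(\<Sum>a\<in>active w. ?g a) = (\<Sum>a\<in>?H. ?g a) + (\<Sum>a\<in>?L. ?g a)"
    by (metis (no_types, lifting) sum.union_disjoint finite_active finite_Un disjoint_iff mem_Collect_eq not_le)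
  then show ?thesis by (simp add: H L succ_rule_def)
qed

lemma plane_perms_1: "plane_perms 1 = {[0]}"
proof -
  have "w = [0]" if "distinct w" "set w = {..<Suc 0}" for w
  proof -
    have "length w = 1" using that distinct_card by fastforce
    then obtain x where "w = [x]" by (auto simp: length_Suc_conv)
    then show ?thesis using that by auto
  qed
  then show ?thesis by (auto simp: plane_perms_def plane_def)
qed

lemma succ_rule_nonneg: "(\<And>h k. 0 \<le> f h k) \<Longrightarrow> 0 \<le> succ_rule f h k"
  unfolding succ_rule_def by (intro add_nonneg_nonneg sum_nonneg) auto

text \<open>Summing \<open>f\<close> over the children of a node evaluates
  \<open>succ_rule f\<close> at its label, so each generation is absorbed into the function and the
  induction runs over all nonnegative \<open>f\<close>. The root \<open>[0]\<close> has label
  \<open>(1, 1)\<close>.\<close>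

lemma sum_plane_perms_le:
  assumes "\<And>h k. 0 \<le> f h k"
  shows "(\<Sum>w\<in>plane_perms (Suc n). f (above w) (below w)) \<le> (succ_rule ^^ n) f 1 1"
  using assms
proof (induction n arbitrary: f)
  case 0
  have "active [0] = {0, 1}" by (auto simp: active_def)
  then have "{a \<in> active [0]. 0 < a} = {1}" "{a \<in> active [0]. a = 0} = {0}" by auto
  then have "above [0] = 1" "below [0] = 1" by (simp_all add: above_def below_def)
  then show ?case using plane_perms_1 by simp
next
  case (Suc n)
  let ?S = "SIGMA w:plane_perms (Suc n). active w"
  let ?f = "\<lambda>w. f (above w) (below w)"
  have fin: "finite ?S" by (intro finite_SigmaI finite_plane_perms) simp
  have "(\<Sum>w\<in>plane_perms (Suc (Suc n)). ?f w) \<le> (\<Sum>w\<in>(\<lambda>(w, a). child w a) ` ?S. ?f w)"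
    by (rule sum_mono2) (use fin plane_perms_Suc_subset Suc.prems in auto)
  also have "\<dots> \<le> (\<Sum>p\<in>?S. (?f \<circ> (\<lambda>(w, a). child w a)) p)"
    by (rule sum_image_le) (use fin Suc.prems in auto)
  also have "\<dots> = (\<Sum>w\<in>plane_perms (Suc n). \<Sum>a\<in>active w. ?f (child w a))"
    by (subst sum.Sigma) (auto simp: finite_plane_perms intro!: sum.cong)
  also have "\<dots> = (\<Sum>w\<in>plane_perms (Suc n). succ_rule f (above w) (below w))"
  proof (rule sum.cong)
    fix w assume w: "w \<in> plane_perms (Suc n)"
    then have "w \<noteq> []" using plane_perms_length[OF w] by auto
    then show "(\<Sum>a\<in>active w. ?f (child w a)) = succ_rule f (above w) (below w)"
      by (rule sum_children[OF w])
  qed simp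
  also have "\<dots> \<le> (succ_rule ^^ n) (succ_rule f) 1 1"
    by (rule Suc.IH) (rule succ_rule_nonneg[OF Suc.prems])
  finally show ?case by (simp add: funpow_swap1)
qed

lemma card_plane_perms_le: "real (card (plane_perms (Suc n))) \<le> (succ_rule ^^ n) (\<lambda>_ _. 1) 1 1"
  using sum_plane_perms_le[of "\<lambda>_ _. 1" n] by simp

subsection \<open>Representing placements by plane permutations\<close>

lemma finite_has_max:
  fixes f :: "'a \<Rightarrow> real"
  assumes "finite S" "S \<noteq> {}"
  shows "\<exists>t\<in>S. \<forall>j\<in>S. f j \<le> f t"
proof -
  have "Max (f ` S) \<in> f ` S" using assms by (intro Max_in) auto
  then obtain t where "t \<in> S" "f t = Max (f ` S)" by force
  moreover have "\<forall>j\<in>S. f j \<le> Max (f ` S)" using assms by simp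
  ultimately show ?thesis by force
qed

text \<open>Set aside \<open>t\<close> with the rightmost left edge and take a suitable
  \<open>i\<close> among the rest. If \<open>t\<close> spoils \<open>i\<close>, then
  \<open>i\<close> is south of \<open>t\<close>, every other \<open>j\<close> is south of
  \<open>i\<close>, and \<open>t\<close> itself is west or north of all others.\<close>

lemma exists_unblocked:
  fixes xl xh yl yh :: "nat \<Rightarrow> real"
  assumes "finite S" "S \<noteq> {}"
    and "\<And>i. i \<in> S \<Longrightarrow> xl i < xh i \<and> yl i < yh i"
    and "\<And>i j. i \<in> S \<Longrightarrow> j \<in> S \<Longrightarrow> i \<noteq> j \<Longrightarrow>
      xh i \<le> xl j \<or> xh j \<le> xl i \<or> yh i \<le> yl j \<or> yh j \<le> yl i"
  shows "\<exists>i\<in>S. \<forall>j\<in>S - {i}. xh i \<le> xl j \<or> yh j \<le> yl i"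
  using assms
proof (induction "card S" arbitrary: S)
  case 0
  then show ?case by simp
next
  case (Suc m)
  obtain t where t: "t \<in> S" "\<And>j. j \<in> S \<Longrightarrow> xl j \<le> xl t"
    using finite_has_max[OF Suc.prems(1,2), of xl] by blast
  show ?case
  proof (cases "S = {t}")
    case False
    have "\<exists>i\<in>S - {t}. \<forall>j\<in>S - {t} - {i}. xh i \<le> xl j \<or> yh j \<le> yl i"
    proof (rule Suc.hyps(1))
      show "m = card (S - {t})" using Suc.hyps(2) t(1) Suc.prems(1) by simp
    qed (use Suc.prems t(1) False in auto)
    then obtain i where i: "i \<in> S" "i \<noteq> t"
      and ib: "\<And>j. j \<in> S \<Longrightarrow> j \<noteq> t \<Longrightarrow> j \<noteq> i \<Longrightarrow> xh i \<le> xl j \<or> yh j \<le> yl i" by blast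
    show ?thesis
    proof (cases "xh i \<le> xl t \<or> yh t \<le> yl i")
      case True
      with i ib show ?thesis by blast
    next
      case blocked: False
      have "yh i \<le> yl t"
        using Suc.prems(4)[OF i(1) t(1) i(2)] blocked t(2)[OF i(1)] Suc.prems(3)[OF t(1)] by linarith
      have "xh t \<le> xl j \<or> yh j \<le> yl t" if j: "j \<in> S" "j \<noteq> t" for j
      proof (cases "j = i")
        case True
        then show ?thesis using \<open>yh i \<le> yl t\<close> by simp
      next
        case False
        then show ?thesis
          using ib[OF j False] t(2)[OF j(1)] blocked \<open>yh i \<le> yl t\<close> Suc.prems(3)[OF i(1)] by linarith
      qed
      with t(1) show ?thesis by blast
    qed
  qed (use t in auto)
qed

text \<open>The next rectangle is always an admissible one with the highest bottom edge. If its
  successor was admissible too, that choice prevents it from lying north. Otherwise the successor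
  was blocked by the chosen rectangle alone, which excludes the same relation.\<close>

lemma exists_greedy_order:
  fixes xl xh yl yh :: "nat \<Rightarrow> real"
  assumes "finite S"
    and "\<And>i. i \<in> S \<Longrightarrow> xl i < xh i \<and> yl i < yh i"
    and "\<And>i j. i \<in> S \<Longrightarrow> j \<in> S \<Longrightarrow> i \<noteq> j \<Longrightarrow>
      xh i \<le> xl j \<or> xh j \<le> xl i \<or> yh i \<le> yl j \<or> yh j \<le> yl i"
  shows "\<exists>xs. distinct xs \<and> set xs = S \<and> sorted_wrt (\<lambda>i j. xh i \<le> xl j \<or> yh j \<le> yl i) xs \<and>
    (\<forall>p. Suc p < length xs \<longrightarrow> \<not> yh (xs ! p) \<le> yl (xs ! Suc p))"
  using assms
proof (induction "card S" arbitrary: S)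
  case 0
  then show ?case by (intro exI[of _ "[]"]) simp
next
  case (Suc m)
  let ?R = "\<lambda>i j. xh i \<le> xl j \<or> yh j \<le> yl i"
  define U where "U = {i \<in> S. \<forall>j\<in>S - {i}. ?R i j}"
  have "S \<noteq> {}" using Suc.hyps(2) by auto
  then have "\<exists>i\<in>S. \<forall>j\<in>S - {i}. ?R i j"
    by (intro exists_unblocked[of S xl xh yl yh] Suc.prems)
  then obtain i0 where "i0 \<in> S" "\<forall>j\<in>S - {i0}. ?R i0 j" by blast
  then have "i0 \<in> U" by (simp add: U_def)
  then have "U \<noteq> {}" by blast
  moreover have "finite U" using Suc.prems(1) by (simp add: U_def)
  ultimately obtain i where i: "i \<in> U" "\<And>j. j \<in> U \<Longrightarrow> yl j \<le> yl i"
    using finite_has_max[of U yl] by blast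
  have iS: "i \<in> S" and iR: "\<forall>j\<in>S - {i}. ?R i j" using i(1) by (simp_all add: U_def)
  have "\<exists>xs. distinct xs \<and> set xs = S - {i} \<and> sorted_wrt ?R xs \<and>
    (\<forall>p. Suc p < length xs \<longrightarrow> \<not> yh (xs ! p) \<le> yl (xs ! Suc p))"
  proof (rule Suc.hyps(1))
    show "m = card (S - {i})" using Suc.hyps(2) iS Suc.prems(1) by simp
  qed (use Suc.prems in auto)
  then obtain xs where xs: "distinct xs" "set xs = S - {i}" "sorted_wrt ?R xs"
    "\<And>p. Suc p < length xs \<Longrightarrow> \<not> yh (xs ! p) \<le> yl (xs ! Suc p)" by blast
  have "\<not> yh ((i # xs) ! p) \<le> yl ((i # xs) ! Suc p)" if p: "Suc p < length (i # xs)" for p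
  proof (cases p)
    case 0
    then obtain c cs where c: "xs = c # cs" using p by (cases xs) auto
    then have cS: "c \<in> S" "c \<noteq> i" using xs(2) by auto
    have "\<not> yh i \<le> yl c"
    proof (cases "c \<in> U")
      case True
      then show ?thesis using i(2)[OF True] Suc.prems(2)[OF iS] by linarith
    next
      case False
      then obtain j where j: "j \<in> S" "j \<noteq> c" "\<not> ?R c j" using cS by (auto simp: U_def)
      have "j \<notin> set cs" using xs(3) c j(3) by auto
      then have "j = i" using xs(2) c j by auto
      then show ?thesis using j(3) by simp
    qed
    then show ?thesis using 0 c by simp
  next
    case (Suc q)
    then show ?thesis using xs(4)[of q] p by simp
  qed
  moreover have "sorted_wrt ?R (i # xs)" using xs(2,3) iR by simp
  moreover have "distinct (i # xs)" "set (i # xs) = S" using xs iS by auto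
  ultimately show ?case by blast
qed

section \<open>From a pair of orders to a representation\<close>

definition index_in :: "nat list \<Rightarrow> nat \<Rightarrow> nat" where
  "index_in xs = the_inv_into {..<length xs} ((!) xs)"

lemma index_in_nth: "distinct xs \<Longrightarrow> p < length xs \<Longrightarrow> index_in xs (xs ! p) = p"
  unfolding index_in_def by (rule the_inv_into_f_f) (auto simp: inj_on_def nth_eq_iff_index_eq)

lemma index_in_less:
  assumes "distinct xs" "x \<in> set xs"
  shows "index_in xs x < length xs" "xs ! index_in xs x = x"
proof -
  obtain p where "p < length xs" "xs ! p = x" using assms(2) by (auto simp: in_set_conv_nth)
  then show "index_in xs x < length xs" "xs ! index_in xs x = x"
    using index_in_nth[OF assms(1), of p] by simp_all
qed

text \<open>The list \<open>xs\<close> is the order by west or north, and \<open>w ! p\<close> is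
  the position of \<open>xs ! p\<close> in the order by west or south. Where the orders agree only
  west or east is possible, where they disagree only north or south.\<close>

definition perm_rep :: "nat \<Rightarrow> nat list \<times> nat list \<Rightarrow> nat \<times> nat \<Rightarrow> direction" where
  "perm_rep n = (\<lambda>(xs, w). restrict (\<lambda>(x, y).
     let p = index_in xs x; q = index_in xs y
     in if p < q then if w ! p < w ! q then West else North
        else if w ! p < w ! q then South else East) (off_diagonal n))"

text \<open>A discrete intermediate value argument, used to replace the 2 and the 3 of a pattern by
  consecutive values.\<close>

lemma exists_switch:
  fixes m n :: nat
  assumes "m < n" "Q m" "\<not> Q n"
  shows "\<exists>v. m \<le> v \<and> v < n \<and> Q v \<and> \<not> Q (Suc v)"
  using assms
proof (induction "n - m" arbitrary: n)
  case (Suc d)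
  show ?case
  proof (cases "Q (n - 1)")
    case True
    then show ?thesis using Suc.prems by (intro exI[of _ "n - 1"]) auto
  next
    case False
    then have "n - 1 \<noteq> m" using Suc.prems by auto
    then have "\<exists>v. m \<le> v \<and> v < n - 1 \<and> Q v \<and> \<not> Q (Suc v)"
      using Suc.hyps(2) Suc.prems False by (intro Suc.hyps(1)) auto
    then show ?thesis by auto
  qed
qed simp

lemma feasible_represented:
  assumes "feasible n P"
  shows "\<exists>xs\<in>permutations_of_set {1..n}. \<exists>w\<in>plane_perms n. represents n (perm_rep n (xs, w)) P"
proof -
  let ?S = "{1..n}"
  have pos: "xmin P i < xmax P i \<and> ymin P i < ymax P i" if "i \<in> ?S" for i
    using assms that by (auto simp: feasible_def is_placement_def)
  have sep: "xmax P i \<le> xmin P j \<or> xmax P j \<le> xmin P i \<or> ymax P i \<le> ymin P j \<or> ymax P j \<le> ymin P i"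
    if "i \<in> ?S" "j \<in> ?S" "i \<noteq> j" for i j
  proof -
    have "(i, j) \<in> off_diagonal n" using that by (auto simp: off_diagonal_def)
    then obtain d where "spatial_rel P d i j" using assms by (auto simp: feasible_def)
    then show ?thesis by (cases d) auto
  qed
  obtain xs where xs: "distinct xs" "set xs = ?S"
    "sorted_wrt (\<lambda>i j. xmax P i \<le> xmin P j \<or> ymax P j \<le> ymin P i) xs"
    "\<And>p. Suc p < length xs \<Longrightarrow> \<not> ymax P (xs ! p) \<le> ymin P (xs ! Suc p)"
    using exists_greedy_order[of ?S "xmin P" "xmax P" "ymin P" "ymax P"] pos sep by auto
  \<comment> \<open>Negating the vertical axis turns the greedy construction into an order by west
    or south.\<close>
  have "\<exists>ys. distinct ys \<and> set ys = ?S \<and>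
     sorted_wrt (\<lambda>i j. xmax P i \<le> xmin P j \<or> - ymin P j \<le> - ymax P i) ys \<and>
     (\<forall>p. Suc p < length ys \<longrightarrow> \<not> - ymin P (ys ! p) \<le> - ymax P (ys ! Suc p))"
    by (rule exists_greedy_order) (use pos sep in fastforce)+
  then obtain ys where ys: "distinct ys" "set ys = ?S"
    "sorted_wrt (\<lambda>i j. xmax P i \<le> xmin P j \<or> ymax P i \<le> ymin P j) ys"
    "\<And>p. Suc p < length ys \<Longrightarrow> \<not> ymax P (ys ! Suc p) \<le> ymin P (ys ! p)"
    by auto
  have lx: "length xs = n" using distinct_card[OF xs(1)] xs(2) by simp
  have ly: "length ys = n" using distinct_card[OF ys(1)] ys(2) by simp
  define w where "w = map (index_in ys) xs"
  have lw: "length w = n" by (simp add: w_def lx)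
  have w_less: "w ! p < n" and ys_w: "ys ! (w ! p) = xs ! p" if "p < n" for p
    using index_in_less[OF ys(1), of "xs ! p"] that xs(2) ys(2) lx ly nth_mem[of p xs]
    by (simp_all add: w_def)
  have xs_rel: "xmax P (xs ! p) \<le> xmin P (xs ! q) \<or> ymax P (xs ! q) \<le> ymin P (xs ! p)"
    if "p < q" "q < n" for p q
    using sorted_wrt_nth_less[OF xs(3), of p q] that lx by simp
  have ys_rel: "xmax P (xs ! p) \<le> xmin P (xs ! q) \<or> ymax P (xs ! p) \<le> ymin P (xs ! q)"
    if "w ! p < w ! q" "p < n" "q < n" for p q
    using sorted_wrt_nth_less[OF ys(3) that(1)] w_less[of q] ys_w[of p] ys_w[of q] that ly by simp
  have pos_xs: "xmin P (xs ! p) < xmax P (xs ! p) \<and> ymin P (xs ! p) < ymax P (xs ! p)" if "p < n" for p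
    using pos[of "xs ! p"] xs(2) lx nth_mem[of p xs] that by simp
  have inj_ys: "inj_on (index_in ys) (set xs)"
    by (metis index_in_less(2) inj_onI xs(2) ys(1) ys(2))
  have dw: "distinct w" using inj_ys xs(1) by (simp add: w_def distinct_map)
  have sw: "set w = {..<n}"
  proof (rule card_subset_eq)
    show "set w \<subseteq> {..<n}" using w_less lw by (auto simp: in_set_conv_nth)
    show "card (set w) = card {..<n}" using distinct_card[OF dw] lw by simp
  qed simp
  have "plane w"
    unfolding plane_def
  proof (intro notI, elim exE conjE)
    fix i j k
    assume *: "i < j" "Suc j < k" "k < length w" "w ! j < w ! i" "w ! i < w ! k" "w ! k < w ! Suc j"
    \<comment> \<open>The pattern is refined to consecutive values \<open>v\<close> at
      \<open>a < j\<close> and \<open>Suc v\<close> at \<open>d > Suc j\<close>, which are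
      neighbours in \<open>ys\<close>, so the greedy condition there applies.\<close>
    let ?Q = "\<lambda>v. \<exists>p<j. w ! p = v"
    have "\<not> ?Q (w ! k)" using * dw by (auto simp: nth_eq_iff_index_eq)
    then obtain v where v: "w ! i \<le> v" "v < w ! k" "?Q v" "\<not> ?Q (Suc v)"
      using exists_switch[of "w ! i" "w ! k" ?Q] *(1,5) by blast
    obtain a where a: "a < j" "w ! a = v" using v(3) by blast
    have "Suc v \<in> set w" using v(2) w_less[of k] * lw by (auto simp: sw)
    then obtain d where d: "d < n" "w ! d = Suc v" using lw by (auto simp: in_set_conv_nth)
    have "\<not> d < j" using v(4) d by blast
    moreover have "d \<noteq> j" "d \<noteq> Suc j" using d(2) v * by auto
    ultimately have dj: "Suc j < d" by linarith
    have n: "a < n" "j < n" "Suc j < n" using a(1) * lw by auto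
    have "\<not> ymax P (xs ! d) \<le> ymin P (xs ! a)"
      using ys(4)[of v] ys_w[OF d(1)] ys_w[OF n(1)] w_less[OF d(1)] d(2) a(2) ly by simp
    moreover have "\<not> ymax P (xs ! j) \<le> ymin P (xs ! Suc j)" using xs(4)[of j] n lx by simp
    moreover have "ymax P (xs ! j) \<le> ymin P (xs ! a)"
    proof -
      have "w ! j < w ! a" using a v *(4) by simp
      then show ?thesis using xs_rel[OF a(1) n(2)] ys_rel[OF _ n(2,1)] pos_xs[OF n(1)] pos_xs[OF n(2)] by linarith
    qed
    moreover have "ymax P (xs ! d) \<le> ymin P (xs ! Suc j)"
    proof -
      have "w ! d < w ! Suc j" using d v *(6) by simp
      then show ?thesis using xs_rel[OF dj d(1)] ys_rel[OF _ d(1) n(3)] pos_xs[OF d(1)] pos_xs[OF n(3)] by linarith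
    qed
    \<comment> \<open>The top of \<open>xs ! j\<close> is at most the bottom of
      \<open>xs ! a\<close>, hence below the top of \<open>xs ! d\<close>, hence below the bottom of
      \<open>xs ! Suc j\<close>, against the greedy condition on \<open>xs\<close>.\<close>
    ultimately show False by linarith
  qed
  then have w: "w \<in> plane_perms n" using dw sw by (simp add: plane_perms_def)
  have "represents n (perm_rep n (xs, w)) P"
    unfolding represents_def
  proof clarify
    fix x y assume xy: "(x, y) \<in> off_diagonal n"
    then have "x \<in> set xs" "y \<in> set xs" "x \<noteq> y" using xs(2) by (auto simp: off_diagonal_def)
    then obtain p q where pq: "p < n" "x = xs ! p" "q < n" "y = xs ! q" "p \<noteq> q"
      using lx by (metis in_set_conv_nth)
    have ix: "index_in xs x = p" "index_in xs y = q" using pq index_in_nth[OF xs(1)] lx by auto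
    have "w ! p \<noteq> w ! q" using pq dw lw by (simp add: nth_eq_iff_index_eq)
    moreover have rep: "perm_rep n (xs, w) (x, y) =
        (if p < q then if w ! p < w ! q then West else North
         else if w ! p < w ! q then South else East)"
      using xy by (simp add: perm_rep_def ix Let_def)
    ultimately show "spatial_rel P (perm_rep n (xs, w) (x, y)) x y"
      using xs_rel[of p q] xs_rel[of q p] ys_rel[of p q] ys_rel[of q p] pq(1,3,5) pos_xs[of p] pos_xs[of q]
      unfolding rep unfolding pq(2,4) by (auto split: if_splits)
  qed
  moreover have "xs \<in> permutations_of_set ?S" using xs by (simp add: permutations_of_set_def)
  ultimately show ?thesis using w by blast
qed

lemma exists_complete_representations:
  "\<exists>R. complete_representations n R \<and> card R \<le> fact n * card (plane_perms n)"
proof -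
  let ?X = "permutations_of_set {1..n} \<times> plane_perms n"
  have fin: "finite ?X" by (simp add: finite_plane_perms)
  have "complete_representations n (perm_rep n ` ?X)"
    unfolding complete_representations_def
  proof (intro conjI allI impI)
    show "perm_rep n ` ?X \<subseteq> direction_maps n"
      by (auto simp: perm_rep_def direction_maps_def)
    show "\<exists>r\<in>perm_rep n ` ?X. represents n r P" if "feasible n P" for P
      using feasible_represented[OF that] by blast
  qed
  moreover have "card (perm_rep n ` ?X) \<le> fact n * card (plane_perms n)"
    using card_image_le[OF fin, of "perm_rep n"] by (simp add: card_cartesian_product)
  ultimately show ?thesis by blast
qed

subsection \<open>Laurent polynomials on circles\<close>

lemma has_integral_cis:
  fixes m :: int
  shows "((\<lambda>t. cis (of_int m * t)) has_integral (if m = 0 then 2 * pi else 0)) {-pi..pi}"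
proof (cases "m = 0")
  case True
  then show ?thesis using has_integral_const_real[of "1::complex" "-pi" pi]
    by (simp add: scaleR_conv_of_real)
next
  case False
  let ?F = "\<lambda>t. inverse (\<i> * of_int m) * cis (of_int m * t)"
  have "(?F has_vector_derivative inverse (\<i> * of_int m) * (\<i> * of_int m * cis (of_int m * t))) (at t within {-pi..pi})" for t
  proof (rule has_vector_derivative_mult_right)
    show "((\<lambda>t. cis (of_int m * t)) has_vector_derivative \<i> * of_int m * cis (of_int m * t)) (at t within {-pi..pi})"
      unfolding has_vector_derivative_def
      by (rule derivative_eq_intros refl)+ (simp add: fun_eq_iff scaleR_conv_of_real)
  qed
  moreover have "inverse (\<i> * of_int m) * (\<i> * of_int m * cis (of_int m * t)) = cis (of_int m * t)" for t
    using False by (simp add: field_simps)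
  ultimately have "(?F has_vector_derivative cis (of_int m * t)) (at t within {-pi..pi})" for t
    by metis
  then have "((\<lambda>t. cis (of_int m * t)) has_integral (?F pi - ?F (-pi))) {-pi..pi}"
    by (intro fundamental_theorem_of_calculus) auto
  moreover have "cis (of_int m * pi) = cis (of_int m * (-pi))"
  proof -
    have "cis (of_int m * pi) = cis (of_int m * (-pi) + 2 * pi * of_int m)" by (simp add: algebra_simps)
    also have "\<dots> = cis (of_int m * (-pi)) * cis (2 * pi * of_int m)" by (simp only: cis_mult)
    also have "cis (2 * pi * of_int m) = 1" by (simp add: cis_multiple_2pi)
    finally show ?thesis by simp
  qed
  ultimately have "((\<lambda>t. cis (of_int m * t)) has_integral 0) {-pi..pi}"
    by (simp only: diff_self)
  then show ?thesis using False by simp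
qed

lemma has_integral_circle_power:
  fixes c :: complex
  assumes "c \<noteq> 0"
  shows "((\<lambda>t. (c * cis t) ^ i / (c * cis t) ^ N) has_integral (if i = N then 2 * pi else 0)) {-pi..pi}"
proof -
  have "cis (of_int (int i - int N) * t) = cis t ^ i / cis t ^ N" for t
    by (simp only: Complex.DeMoivre cis_divide) (simp add: algebra_simps)
  then have "(c * cis t) ^ i / (c * cis t) ^ N = c ^ i / c ^ N * cis (of_int (int i - int N) * t)" for t
    by (simp add: power_mult_distrib)
  then show ?thesis
    using has_integral_mult_right[OF has_integral_cis[of "int i - int N"], of "c ^ i / c ^ N"] assms by auto
qed

lemma has_integral_circle_power_inverse:
  fixes c r :: complex
  assumes "c \<noteq> 0" "r \<noteq> 0"
  shows "((\<lambda>t. (c / (r * cis t)) ^ i / (c / (r * cis t)) ^ N) has_integral (if i = N then 2 * pi else 0)) {-pi..pi}"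
proof -
  have "(c / (r * cis t)) ^ i / (c / (r * cis t)) ^ N = c ^ i / c ^ N * ((r * cis t) ^ N / (r * cis t) ^ i)" for t
    using assms by (simp add: power_divide field_simps)
  then show ?thesis
    using has_integral_mult_right[OF has_integral_circle_power[OF assms(2), of N i], of "c ^ i / c ^ N"] assms by auto
qed

text \<open>In this encoding the coefficient \<open>N\<close> of \<open>p\<close> is the constant
  term of \<open>f\<close>.\<close>

definition laurent :: "(complex \<Rightarrow> complex) \<Rightarrow> bool" where
  "laurent f \<longleftrightarrow> (\<exists>p N. \<forall>z. z \<noteq> 0 \<longrightarrow> f z = poly p z / z ^ N)"

lemma laurentI: "(\<And>z. z \<noteq> 0 \<Longrightarrow> f z = poly p z / z ^ N) \<Longrightarrow> laurent f"
  unfolding laurent_def by blast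

lemma laurent_const: "laurent (\<lambda>z. c)"
  by (rule laurentI[of _ "[:c:]" 0]) simp

lemma laurent_ident: "laurent (\<lambda>z. z)"
  by (rule laurentI[of _ "[:0, 1:]" 0]) simp

lemma laurent_inverse: "laurent inverse"
  by (rule laurentI[of _ "[:1:]" 1]) (simp add: field_simps)

lemma laurent_add:
  assumes "laurent f" "laurent g"
  shows "laurent (\<lambda>z. f z + g z)"
proof -
  obtain p N where f: "\<And>z. z \<noteq> 0 \<Longrightarrow> f z = poly p z / z ^ N" using assms(1) by (auto simp: laurent_def)
  obtain q M where g: "\<And>z. z \<noteq> 0 \<Longrightarrow> g z = poly q z / z ^ M" using assms(2) by (auto simp: laurent_def)
  show ?thesis
    by (rule laurentI[of _ "monom 1 M * p + monom 1 N * q" "N + M"])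
      (simp add: f g poly_monom field_simps power_add)
qed

lemma laurent_mult:
  assumes "laurent f" "laurent g"
  shows "laurent (\<lambda>z. f z * g z)"
proof -
  obtain p N where f: "\<And>z. z \<noteq> 0 \<Longrightarrow> f z = poly p z / z ^ N" using assms(1) by (auto simp: laurent_def)
  obtain q M where g: "\<And>z. z \<noteq> 0 \<Longrightarrow> g z = poly q z / z ^ M" using assms(2) by (auto simp: laurent_def)
  show ?thesis
    by (rule laurentI[of _ "p * q" "N + M"]) (simp add: f g power_add)
qed

lemma laurent_circle_integral:
  fixes p :: "complex poly" and f :: "complex \<Rightarrow> complex"
  assumes f: "\<And>z. z \<noteq> 0 \<Longrightarrow> f z = poly p z / z ^ N" and "c \<noteq> 0"
  shows "((\<lambda>t. f (c * cis t)) has_integral 2 * pi * coeff p N) {-pi..pi}"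
proof -
  have eq: "f (c * cis t) = (\<Sum>i\<le>degree p. coeff p i * ((c * cis t) ^ i / (c * cis t) ^ N))" for t
    using assms by (simp add: poly_altdef sum_divide_distrib)
  have "((\<lambda>t. f (c * cis t)) has_integral (\<Sum>i\<le>degree p. coeff p i * of_real (if i = N then 2 * pi else 0))) {-pi..pi}"
    unfolding eq by (intro has_integral_sum has_integral_mult_right has_integral_circle_power assms) simp
  also have "(\<Sum>i\<le>degree p. coeff p i * of_real (if i = N then 2 * pi else 0)) = 2 * pi * coeff p N"
    by (simp add: if_distrib sum.delta le_degree not_le coeff_eq_0 cong: if_cong)
  finally show ?thesis .
qed

lemma laurent_circle_integral_inverse:
  fixes p :: "complex poly" and f :: "complex \<Rightarrow> complex"
  assumes f: "\<And>z. z \<noteq> 0 \<Longrightarrow> f z = poly p z / z ^ N" and "c \<noteq> 0" "r \<noteq> 0"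
  shows "((\<lambda>t. f (c / (r * cis t))) has_integral 2 * pi * coeff p N) {-pi..pi}"
proof -
  have eq: "f (c / (r * cis t)) = (\<Sum>i\<le>degree p. coeff p i * ((c / (r * cis t)) ^ i / (c / (r * cis t)) ^ N))" for t
    using assms by (simp add: poly_altdef sum_divide_distrib)
  have "((\<lambda>t. f (c / (r * cis t))) has_integral (\<Sum>i\<le>degree p. coeff p i * of_real (if i = N then 2 * pi else 0))) {-pi..pi}"
    unfolding eq by (intro has_integral_sum has_integral_mult_right has_integral_circle_power_inverse assms) simp
  also have "(\<Sum>i\<le>degree p. coeff p i * of_real (if i = N then 2 * pi else 0)) = 2 * pi * coeff p N"
    by (simp add: if_distrib sum.delta le_degree not_le coeff_eq_0 cong: if_cong)
  finally show ?thesis .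
qed

text \<open>Both sides are \<open>2 * pi\<close> times the constant term, which is independent of
  the radius and preserved by \<open>z -> c / z\<close>. Hence \<open>c\<close> may vary with an
  outer variable while the contour stays fixed.\<close>

lemma laurent_integral_invert:
  assumes "laurent f" "c \<noteq> 0" "r \<noteq> 0"
  shows "integral {-pi..pi} (\<lambda>t. f (c / (r * cis t))) = integral {-pi..pi} (\<lambda>t. f (r * cis t))"
proof -
  obtain p N where f: "\<And>z. z \<noteq> 0 \<Longrightarrow> f z = poly p z / z ^ N" using assms(1) by (auto simp: laurent_def)
  show ?thesis
    using laurent_circle_integral[OF f assms(3)] laurent_circle_integral_inverse[OF f assms(2,3)]
    by (simp add: integral_unique)
qed

subsection \<open>Double integrals\<close>

definition box_integral :: "(real \<Rightarrow> real \<Rightarrow> complex) \<Rightarrow> complex" where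
  "box_integral G = integral {-pi..pi} (\<lambda>s. integral {-pi..pi} (G s))"

text \<open>Joint continuity guarantees that the iterated integrals exist and can be
  exchanged.\<close>

definition cont2 :: "(real \<Rightarrow> real \<Rightarrow> complex) \<Rightarrow> bool" where
  "cont2 G \<longleftrightarrow> continuous_on UNIV (\<lambda>(s, t). G s t)"

lemma cont2_inner:
  assumes "cont2 G"
  shows "G s integrable_on {-pi..pi}"
proof -
  have "continuous_on UNIV ((\<lambda>(s, t). G s t) \<circ> Pair s)"
    by (rule continuous_on_compose)
      (auto intro!: continuous_intros intro: continuous_on_subset[OF assms[unfolded cont2_def]])
  then have "continuous_on UNIV (G s)" by (simp add: comp_def)
  then show ?thesis by (intro integrable_continuous_real) (auto intro: continuous_on_subset)
qed

lemma cont2_outer: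
  assumes "cont2 G"
  shows "(\<lambda>s. integral {-pi..pi} (G s)) integrable_on {-pi..pi}"
proof (rule integrable_continuous_real)
  have "continuous_on {-pi..pi} (\<lambda>s. integral (cbox (-pi) pi) (G s))"
    by (rule integral_continuous_on_param) (use assms in \<open>auto simp: cont2_def intro: continuous_on_subset\<close>)
  then show "continuous_on {-pi..pi} (\<lambda>s. integral {-pi..pi} (G s))" by simp
qed

lemma box_integral_add:
  assumes "cont2 G" "cont2 H"
  shows "box_integral (\<lambda>s t. G s t + H s t) = box_integral G + box_integral H"
  unfolding box_integral_def
  by (simp add: integral_add[OF cont2_inner cont2_inner] integral_add[OF cont2_outer cont2_outer] assms)

lemma box_integral_cmult: "box_integral (\<lambda>s t. c * G s t) = c * box_integral G"
  unfolding box_integral_def by simp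

lemma box_integral_swap:
  assumes "cont2 G"
  shows "box_integral (\<lambda>s t. G t s) = box_integral G"
proof -
  have "continuous_on (cbox (-pi, -pi) (pi, pi)) (\<lambda>(s, t). G s t)"
    using assms unfolding cont2_def by (rule continuous_on_subset) simp
  from integral_swap_continuous[OF this] show ?thesis by (simp add: box_integral_def)
qed

lemma norm_box_integral_le:
  assumes "cont2 G"
    and bound: "\<And>s t. s \<in> {-pi..pi} \<Longrightarrow> t \<in> {-pi..pi} \<Longrightarrow> norm (G s t) \<le> K * (h s * h t)"
    and h: "(h has_integral I) {-pi..pi}"
  shows "norm (box_integral G) \<le> K * I\<^sup>2"
proof -
  have "norm (integral {-pi..pi} (G s)) \<le> (K * I) * h s" if "s \<in> {-pi..pi}" for s
  proof -
    have hi: "((\<lambda>t. K * (h s * h t)) has_integral K * (h s * I)) {-pi..pi}"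
      by (intro has_integral_mult_right h)
    have "norm (integral {-pi..pi} (G s)) \<le> integral {-pi..pi} (\<lambda>t. K * (h s * h t))"
      using that hi by (intro integral_norm_bound_integral cont2_inner assms) auto
    then show ?thesis unfolding integral_unique[OF hi] by (simp add: mult_ac)
  qed
  moreover have hi: "((\<lambda>s. (K * I) * h s) has_integral (K * I) * I) {-pi..pi}"
    by (intro has_integral_mult_right h)
  ultimately have "norm (box_integral G) \<le> integral {-pi..pi} (\<lambda>s. (K * I) * h s)"
    unfolding box_integral_def by (intro integral_norm_bound_integral cont2_outer assms) auto
  then show ?thesis unfolding integral_unique[OF hi] by (simp add: power2_eq_square mult_ac)
qed

subsection \<open>The golden torus and the pentagon recurrence\<close>

definition phi :: real where "phi = (1 + sqrt 5) / 2"

lemma phi_sq: "phi * phi = phi + 1"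
  by (simp add: phi_def field_simps)

lemma phi_gt: "1.618 < phi" and phi_lt: "phi < 1.6185"
proof -
  have "2.236 < sqrt 5" by (rule real_less_rsqrt) (simp add: power2_eq_square)
  moreover have "sqrt 5 < 2.237" by (rule real_less_lsqrt) (simp_all add: power2_eq_square)
  ultimately show "1.618 < phi" "phi < 1.6185" by (simp_all add: phi_def)
qed

text \<open>Integrands take all five coordinates, although two determine the rest, so that the
  dihedral group acts by permuting arguments.\<close>

type_synonym cfun = "complex \<Rightarrow> complex \<Rightarrow> complex \<Rightarrow> complex \<Rightarrow> complex \<Rightarrow> complex"

definition chart :: "cfun \<Rightarrow> complex \<Rightarrow> complex \<Rightarrow> complex" where
  "chart F u v = F u v ((1 + v) / u) ((1 + u + v) / (u * v)) ((1 + u) / v)"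

text \<open>The radius \<open>phi\<close> is the positive fixed point of the recurrence, so all five
  coordinates equal \<open>phi\<close> at \<open>s = t = 0\<close>.\<close>

definition torus :: "cfun \<Rightarrow> real \<Rightarrow> real \<Rightarrow> complex" where
  "torus F s t = chart F (of_real phi * cis s) (of_real phi * cis t)"

definition J :: "cfun \<Rightarrow> complex" where
  "J F = box_integral (torus F)"

text \<open>The inverse of the first argument is admitted because \<open>\<alpha> = 1 + 1 / u\<^sub>1\<close>; it is harmless, since the
  reflection used below fixes \<open>u\<^sub>1\<close> and integrates over the second coordinate only.\<close>

inductive cluster :: "cfun \<Rightarrow> bool" where
  const: "cluster (\<lambda>a b c d e. z)"
| fst: "cluster (\<lambda>a b c d e. a)"
| inv: "cluster (\<lambda>a b c d e. inverse a)"
| snd: "cluster (\<lambda>a b c d e. b)"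
| thd: "cluster (\<lambda>a b c d e. c)"
| fth: "cluster (\<lambda>a b c d e. d)"
| vth: "cluster (\<lambda>a b c d e. e)"
| add: "cluster F \<Longrightarrow> cluster G \<Longrightarrow> cluster (\<lambda>a b c d e. F a b c d e + G a b c d e)"
| mult: "cluster F \<Longrightarrow> cluster G \<Longrightarrow> cluster (\<lambda>a b c d e. F a b c d e * G a b c d e)"

lemma cluster_diff:
  assumes "cluster F" "cluster G"
  shows "cluster (\<lambda>a b c d e. F a b c d e - G a b c d e)"
  using cluster.add[OF assms(1) cluster.mult[OF cluster.const[of "-1"] assms(2)]] by simp

lemma cluster_uminus:
  assumes "cluster F"
  shows "cluster (\<lambda>a b c d e. - F a b c d e)"
  using cluster.mult[OF cluster.const[of "-1"] assms] by simp

lemma cluster_power: "cluster F \<Longrightarrow> cluster (\<lambda>a b c d e. F a b c d e ^ n)"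
  by (induction n) (auto intro: cluster.intros)

lemma cluster_sum:
  "(\<And>i. i \<in> A \<Longrightarrow> cluster (F i)) \<Longrightarrow> cluster (\<lambda>a b c d e. \<Sum>i\<in>A. F i a b c d e)"
  by (induction A rule: infinite_finite_induct) (auto intro: cluster.intros)

lemmas cluster_intros = cluster.intros cluster_diff cluster_uminus cluster_power cluster_sum

definition refl1 :: "cfun \<Rightarrow> cfun" where "refl1 F = (\<lambda>a b c d e. F a e d c b)"

lemma cluster_refl1: "cluster F \<Longrightarrow> cluster (refl1 F)"
  unfolding refl1_def by (induction rule: cluster.induct) (auto intro: cluster_intros)

lemma laurent_chart:
  assumes "cluster F"
  shows "laurent (chart F u)"
proof -
  have d: "laurent (\<lambda>v. (1 + u + v) / (u * v))"
    using laurent_mult[OF laurent_mult[OF laurent_const[of "inverse u"] laurent_inverse]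
      laurent_add[OF laurent_const[of "1 + u"] laurent_ident]] by (simp add: divide_inverse mult_ac)
  have e: "laurent (\<lambda>v. (1 + u) / v)"
    using laurent_mult[OF laurent_const[of "1 + u"] laurent_inverse] by (simp add: divide_inverse)
  have c: "laurent (\<lambda>v. (1 + v) / u)"
    using laurent_mult[OF laurent_const[of "inverse u"] laurent_add[OF laurent_const[of 1] laurent_ident]]
    by (simp add: divide_inverse mult_ac)
  show ?thesis
    using assms unfolding chart_def
    by (induction rule: cluster.induct) (auto intro: laurent_const laurent_ident laurent_add laurent_mult c d e)
qed

lemma cont2_torus:
  assumes "cluster F"
  shows "cont2 (torus F)"
  using assms unfolding cont2_def torus_def chart_def case_prod_beta
  using phi_gt by (induction rule: cluster.induct) (auto intro!: continuous_intros)

lemma J_add: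
  assumes "cluster F" "cluster G"
  shows "J (\<lambda>a b c d e. F a b c d e + G a b c d e) = J F + J G"
proof -
  have "torus (\<lambda>a b c d e. F a b c d e + G a b c d e) = (\<lambda>s t. torus F s t + torus G s t)"
    by (simp add: fun_eq_iff torus_def chart_def)
  then show ?thesis by (simp add: J_def box_integral_add cont2_torus assms)
qed

lemma J_cmult: "J (\<lambda>a b c d e. z * F a b c d e) = z * J F"
proof -
  have "torus (\<lambda>a b c d e. z * F a b c d e) = (\<lambda>s t. z * torus F s t)"
    by (simp add: fun_eq_iff torus_def chart_def)
  then show ?thesis by (simp add: J_def box_integral_cmult)
qed

lemma J_sum:
  assumes "\<And>i. i \<in> A \<Longrightarrow> cluster (F i)"
  shows "J (\<lambda>a b c d e. \<Sum>i\<in>A. F i a b c d e) = (\<Sum>i\<in>A. J (F i))"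
  using assms
proof (induction A rule: infinite_finite_induct)
  case (insert x A)
  then show ?case by (simp add: J_add cluster_sum)
qed (use J_cmult[of 0 "\<lambda>_ _ _ _ _. 0"] in simp_all)

lemma one_plus_nonzero:
  fixes u :: complex
  assumes "norm u = phi"
  shows "1 + u \<noteq> 0"
proof
  assume "1 + u = 0"
  then have "u = - 1" by (simp add: eq_neg_iff_add_eq_0 add.commute)
  then show False using assms phi_gt by simp
qed

text \<open>On the torus the five arguments satisfy the pentagon recurrence.\<close>

lemma J_cong:
  assumes "\<And>a b c d e. a \<noteq> 0 \<Longrightarrow> b \<noteq> 0 \<Longrightarrow> c \<noteq> 0 \<Longrightarrow> e \<noteq> 0 \<Longrightarrow> a * c = 1 + b \<Longrightarrow> b * d = 1 + c \<Longrightarrow>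
    c * e = 1 + d \<Longrightarrow> d * a = 1 + e \<Longrightarrow> e * b = 1 + a \<Longrightarrow> F a b c d e = G a b c d e"
  shows "J F = J G"
proof -
  have "torus F s t = torus G s t" for s t
  proof -
    define u v where uv: "u = of_real phi * cis s" "v = of_real phi * cis t"
    have nz: "u \<noteq> 0" "v \<noteq> 0" using phi_gt by (auto simp: uv)
    have n: "norm u = phi" "norm v = phi" using phi_gt by (auto simp: uv norm_mult)
    have "1 + u \<noteq> 0" "1 + v \<noteq> 0"
      using n by (simp_all add: one_plus_nonzero)
    then have "chart F u v = chart G u v"
      unfolding chart_def using nz by (intro assms) (simp_all add: field_simps)
    then show ?thesis by (simp add: torus_def uv)
  qed
  then have "torus F = torus G" by (intro ext)
  then show ?thesis by (simp add: J_def)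
qed

text \<open>For fixed \<open>u\<close> the substitution \<open>v -> (1 + u) / v\<close> exchanges
  the second coordinate with the fifth and the third with the fourth. It inverts the inner circle,
  which preserves the constant term in \<open>v\<close>.\<close>

lemma J_refl1:
  assumes "cluster F"
  shows "J (refl1 F) = J F"
proof -
  have "integral {-pi..pi} (torus (refl1 F) s) = integral {-pi..pi} (torus F s)" for s
  proof -
    define u where "u = of_real phi * cis s"
    have u: "u \<noteq> 0" "norm u = phi" using phi_gt by (auto simp: u_def norm_mult)
    have u1: "1 + u \<noteq> 0"
      using u(2) by (rule one_plus_nonzero)
    have "chart (refl1 F) u v = chart F u ((1 + u) / v)" if "v \<noteq> 0" for v
    proof -
      have "(1 + (1 + u) / v) / u = (1 + u + v) / (u * v)"
        "(1 + u + (1 + u) / v) / (u * ((1 + u) / v)) = (1 + v) / u" "(1 + u) / ((1 + u) / v) = v"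
        using u u1 that by (simp_all add: divide_simps) (simp_all add: algebra_simps)
      then show ?thesis by (simp add: chart_def refl1_def)
    qed
    then have "torus (refl1 F) s = (\<lambda>t. chart F u ((1 + u) / (of_real phi * cis t)))"
      using phi_gt by (simp add: fun_eq_iff torus_def u_def)
    moreover have "torus F s = (\<lambda>t. chart F u (of_real phi * cis t))"
      by (simp add: fun_eq_iff torus_def u_def)
    ultimately show ?thesis
      using laurent_integral_invert[OF laurent_chart[OF assms] u1, of "of_real phi" u] phi_gt by simp
  qed
  then show ?thesis by (simp add: J_def box_integral_def)
qed

text \<open>Exchanging \<open>u\<close> and \<open>v\<close> is another reflection of the pentagon;
  for the integral this is Fubini.\<close>

lemma J_swap:
  assumes "cluster F"
  shows "J (\<lambda>a b c d e. F b a e d c) = J F"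
proof -
  have "torus (\<lambda>a b c d e. F b a e d c) = (\<lambda>s t. torus F t s)"
    by (simp add: torus_def chart_def fun_eq_iff mult.commute add_ac)
  then show ?thesis by (simp add: J_def box_integral_swap[OF cont2_torus[OF assms]])
qed

text \<open>The rotation is the product of the two reflections.\<close>

lemma J_rotate:
  assumes "cluster F"
  shows "J (\<lambda>a b c d e. F b c d e a) = J F"
  using trans[OF J_swap[OF cluster_refl1[OF assms]] J_refl1[OF assms]] unfolding refl1_def .

subsection \<open>An integral solution of the succession rule\<close>

definition vdm :: cfun where
  "vdm a b c d e = (a - b) * (b - c) * (c - d) * (d - e) * (e - a)"

text \<open>The prefactor \<open>a * c\<^sup>2 * d\<close> is chosen so that the two boundary terms
  of the succession rule become antisymmetric under the reflections fixing the third and the first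
  coordinate.\<close>

definition weight :: "nat \<Rightarrow> nat \<Rightarrow> nat \<Rightarrow> cfun" where
  "weight m h k a b c d e = (a * b * c * d * e) ^ m * (a * c\<^sup>2 * d * vdm a b c d e) * (1 + inverse a) ^ h * (1 + c) ^ k"

lemma cluster_weight: "cluster (weight m h k)"
  unfolding weight_def vdm_def by (intro cluster_intros)

lemma J_antisymmetric:
  assumes "cluster F" "\<And>a b c d e. F a e d c b = - F a b c d e"
  shows "J F = 0"
proof -
  have "refl1 F = (\<lambda>a b c d e. (-1) * F a b c d e)" 
  proof (intro ext)
    fix a b c d e
    show "refl1 F a b c d e = (-1) * F a b c d e"
      unfolding refl1_def using assms(2)[of a b c d e] by simp
  qed
  then have "J F = - J F" using J_refl1[OF assms(1)] J_cmult[of "-1" F] by simp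
  then have "2 * J F = 0" by (metis add.right_inverse mult_2)
  then show ?thesis by simp
qed

lemma vdm_reflect: "vdm a e d c b = - vdm a b c d e"
  by (simp add: vdm_def algebra_simps)

lemma vdm_rotate:
  "vdm b c d e a = vdm a b c d e" "vdm c d e a b = vdm a b c d e"
  "vdm d e a b c = vdm a b c d e" "vdm e a b c d = vdm a b c d e"
  unfolding vdm_def by (simp_all only: mult_ac)

text \<open>The boundary term of the first sum. It is antisymmetric under the reflection fixing the
  third coordinate, and two rotations bring that coordinate to the first place.\<close>

lemma J_correction1:
  "J (\<lambda>a b c d e. (a * b * c * d * e) ^ m * c * (1 + c) ^ k * vdm a b c d e) = 0"
proof -
  let ?F = "\<lambda>a b c d e. (a * b * c * d * e) ^ m * a * (1 + a) ^ k * vdm a b c d e"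
  have cl: "cluster ?F" "cluster (\<lambda>a b c d e. ?F b c d e a)"
    unfolding vdm_def by (intro cluster_intros)+
  have "J ?F = 0"
  proof (rule J_antisymmetric[OF cl(1)])
    fix a b c d e :: complex
    have p: "a * e * d * c * b = a * b * c * d * e" by (simp only: mult_ac)
    show "?F a e d c b = - ?F a b c d e" unfolding vdm_reflect[of a b c d e] p by simp
  qed
  moreover have "J (\<lambda>a b c d e. ?F c d e a b) = J ?F"
    using trans[OF J_rotate[OF cl(2)] J_rotate[OF cl(1)]] .
  moreover have "(\<lambda>a b c d e. ?F c d e a b) = (\<lambda>a b c d e. (a * b * c * d * e) ^ m * c * (1 + c) ^ k * vdm a b c d e)"
  proof (intro ext)
    fix a b c d e :: complex
    have p: "c * d * e * a * b = a * b * c * d * e" by (simp only: mult_ac)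
    show "?F c d e a b = (a * b * c * d * e) ^ m * c * (1 + c) ^ k * vdm a b c d e"
      unfolding p vdm_rotate(2)[of c d e a b] ..
  qed
  ultimately show ?thesis by simp
qed

text \<open>The boundary term of the second sum. The reflection fixing the first coordinate
  exchanges the third and fourth, so only \<open>vdm\<close> changes sign.\<close>

lemma J_correction2:
  "J (\<lambda>a b c d e. (a * b * c * d * e) ^ m * (a * c * d)\<^sup>2 * (1 + inverse a) ^ k * vdm a b c d e) = 0"
proof (rule J_antisymmetric)
  show "cluster (\<lambda>a b c d e. (a * b * c * d * e) ^ m * (a * c * d)\<^sup>2 * (1 + inverse a) ^ k * vdm a b c d e)"
    unfolding vdm_def by (intro cluster_intros)
  fix a b c d e :: complex
  have p: "a * e * d * c * b = a * b * c * d * e" "a * d * c = a * c * d" by (simp_all only: mult_ac)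
  show "(a * e * d * c * b) ^ m * (a * d * c)\<^sup>2 * (1 + inverse a) ^ k * vdm a e d c b =
      - ((a * b * c * d * e) ^ m * (a * c * d)\<^sup>2 * (1 + inverse a) ^ k * vdm a b c d e)"
    unfolding vdm_reflect[of a b c d e] p by simp
qed

text \<open>Geometric sums without division: \<open>a\<close> stands for \<open>1 / (x - 1)\<close>
  here and \<open>p\<close> for \<open>y / (y - x)\<close> in the next lemma.\<close>

lemma sum_powers_shifted:
  fixes x a :: complex
  assumes "a * (x - 1) = 1"
  shows "(\<Sum>i = 1..h. x ^ i) = a * x * (x ^ h - 1)"
proof (induction h)
  case (Suc h)
  have "a * x * (x ^ h - 1) + x ^ Suc h * (a * (x - 1)) = a * x * (x ^ Suc h - 1)" by (simp add: algebra_simps)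
  then show ?case using Suc assms by simp
qed simp

lemma sum_mixed_powers:
  fixes x y p :: complex
  assumes "p * (y - x) = y"
  shows "(\<Sum>j = 1..k. x ^ (Suc (h + k) - j) * y ^ j) = p * x ^ Suc h * (y ^ k - x ^ k)"
proof (induction k)
  case (Suc k)
  have "(\<Sum>j = 1..Suc k. x ^ (Suc (h + Suc k) - j) * y ^ j) =
      (\<Sum>j = 1..k. x ^ (Suc (h + Suc k) - j) * y ^ j) + x ^ Suc h * y ^ Suc k" by simp
  also have "(\<Sum>j = 1..k. x ^ (Suc (h + Suc k) - j) * y ^ j) = (\<Sum>j = 1..k. x * (x ^ (Suc (h + k) - j) * y ^ j))"
    by (intro sum.cong) (auto simp: Suc_diff_le)
  also have "\<dots> = x * (p * x ^ Suc h * (y ^ k - x ^ k))" by (simp only: sum_distrib_left[symmetric] Suc)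
  also have "x * (p * x ^ Suc h * (y ^ k - x ^ k)) + x ^ Suc h * y ^ Suc k =
      x * (p * x ^ Suc h * (y ^ k - x ^ k)) + x ^ Suc h * y ^ k * (p * (y - x))"
    by (simp add: assms)
  also have "\<dots> = p * x ^ Suc h * (y ^ Suc k - x ^ Suc k)" by (simp add: algebra_simps)
  finally show ?case .
qed simp

text \<open>Each geometric sum gives a multiple of \<open>x ^ h * y ^ k\<close> and a boundary term.
  Adding \<open>?V1\<close> and \<open>?V2\<close>, whose integrals vanish, cancels the boundary
  terms, and the multiples add up to the factor \<open>\<lambda>\<close>.\<close>

lemma J_weight_step:
  "(\<Sum>i = 1..h. J (weight m i (Suc k))) + (\<Sum>j = 1..k. J (weight m (Suc (h + k) - j) j)) = J (weight (Suc m) h k)"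
proof -
  let ?S1 = "\<lambda>a b c d e. \<Sum>i = 1..h. weight m i (Suc k) a b c d e"
  let ?S2 = "\<lambda>a b c d e. \<Sum>j = 1..k. weight m (Suc (h + k) - j) j a b c d e"
  let ?V1 = "\<lambda>a b c d e. (a * b * c * d * e) ^ Suc m * c * (1 + c) ^ Suc k * vdm a b c d e"
  let ?V2 = "\<lambda>a b c d e. (a * b * c * d * e) ^ m * (a * c * d)\<^sup>2 * (1 + inverse a) ^ Suc (h + k) * vdm a b c d e"
  have cl: "cluster ?S1" "cluster ?S2" "cluster ?V1" "cluster ?V2"
    unfolding weight_def vdm_def by (intro cluster_intros)+
  have "(\<Sum>i = 1..h. J (weight m i (Suc k))) + (\<Sum>j = 1..k. J (weight m (Suc (h + k) - j) j)) =
      J ?S1 + J ?S2 + (J ?V1 + J ?V2)"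
    using J_correction1[of "Suc m" "Suc k"] J_correction2[of m "Suc (h + k)"]
    by (simp add: J_sum cluster_weight)
  also have "\<dots> = J (\<lambda>a b c d e. (?S1 a b c d e + ?S2 a b c d e) + (?V1 a b c d e + ?V2 a b c d e))"
    using cl by (simp only: J_add cluster.add)
  also have "\<dots> = J (weight (Suc m) h k)"
  proof (rule J_cong)
    fix a b c d e :: complex
    assume nz: "a \<noteq> 0" "b \<noteq> 0" "c \<noteq> 0" "e \<noteq> 0"
      and rel: "a * c = 1 + b" "b * d = 1 + c" "c * e = 1 + d" "d * a = 1 + e" "e * b = 1 + a"
    define x y where "x = 1 + inverse a" and "y = 1 + c"
    define L where "L = (a * b * c * d * e) ^ m * vdm a b c d e"
    have x: "a * (x - 1) = 1" "a * x = e * b" using nz rel by (simp_all add: x_def algebra_simps)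
    \<comment> \<open>With \<open>y = b * d\<close> this identifies \<open>y / (y - x)\<close> as
      \<open>d * a\<close>.\<close>
    have "a * (y - x) = b" using nz rel(1) by (simp add: x_def y_def algebra_simps)
    then have y: "(d * a) * (y - x) = y" using rel(2) by (simp only: mult.assoc) (simp add: y_def mult.commute)
    have "?S1 a b c d e = L * (a * c\<^sup>2 * d) * y ^ Suc k * (\<Sum>i = 1..h. x ^ i)"
      by (simp only: weight_def sum_distrib_left x_def y_def L_def) (simp add: mult_ac)
    moreover have "?S2 a b c d e = L * (a * c\<^sup>2 * d) * (\<Sum>j = 1..k. x ^ (Suc (h + k) - j) * y ^ j)"
      by (simp only: weight_def sum_distrib_left x_def y_def L_def) (simp add: mult_ac)
    moreover have "?V1 a b c d e = L * (a * c\<^sup>2 * d) * (e * b) * y ^ Suc k"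
      by (simp add: L_def y_def power2_eq_square)
    moreover have "?V2 a b c d e = L * (a * c\<^sup>2 * d) * (d * a) * x ^ Suc (h + k)"
      by (simp add: L_def x_def power2_eq_square)
    moreover have "weight (Suc m) h k a b c d e = L * (a * c\<^sup>2 * d) * (a * b * c * d * e) * x ^ h * y ^ k"
      by (simp add: weight_def L_def x_def y_def power2_eq_square)
    \<comment> \<open>The eigenvalue \<open>\<lambda>\<close> of the rule arises here.\<close>
    moreover have "a * x * y + d * a * x = a * b * c * d * e"
    proof -
      have "a * x * y + d * a * x = (e * b) * (b * d + d)" using x(2) rel(2) by (simp add: y_def algebra_simps)
      also have "\<dots> = (e * b) * d * (a * c)" using rel(1) by (simp add: algebra_simps)
      finally show ?thesis by (simp add: mult_ac)
    qed
    moreover have "W * y ^ Suc k * (a * x * (x ^ h - 1)) + W * (d * a * x ^ Suc h * (y ^ k - x ^ k)) +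
        (W * (a * x) * y ^ Suc k + W * (d * a) * x ^ Suc (h + k)) =
        W * (a * x * y + d * a * x) * x ^ h * y ^ k" for W
      by (simp add: algebra_simps power_add)
    ultimately show "?S1 a b c d e + ?S2 a b c d e + (?V1 a b c d e + ?V2 a b c d e) = weight (Suc m) h k a b c d e"
      by (simp only: sum_powers_shifted[OF x(1)] sum_mixed_powers[OF y] x(2))
  qed
  finally show ?thesis .
qed

text \<open>The sum over rotations in the next proof produces the left-hand side, and this identity
  turns it into a second factor \<open>vdm\<close>. It holds only modulo the recurrence and is
  checked in the two free variables \<open>a\<close> and \<open>b\<close>.\<close>

lemma cyclic_sum_eq_vdm:
  fixes a b c d e :: complex
  assumes "a \<noteq> 0" "b \<noteq> 0" "a * c = 1 + b" "d * a = 1 + e" "e * b = 1 + a"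
  shows "a * b * (a - b) + b * c * (b - c) + c * d * (c - d) + d * e * (d - e) + e * a * (e - a) = vdm a b c d e"
proof -
  have c: "c = (1 + b) / a" and e: "e = (1 + a) / b" using assms by (simp_all add: eq_divide_eq mult.commute)
  have d: "d = (1 + a + b) / (a * b)"
    unfolding eq_divide_imp[OF assms(1,4)] e using assms(1,2) by (simp add: field_simps)
  show ?thesis
    using assms(1,2) unfolding vdm_def c d e
    by (simp add: divide_simps) (simp add: algebra_simps power2_eq_square power3_eq_cube power4_eq_xxxx)
qed

text \<open>At the root label the integrand is symmetrised over the ten symmetries of the pentagon:
  a reflection gives the factor 2, the five rotations the factor 5.\<close>

lemma J_weight_1_1:
  "10 * J (weight m 1 1) = J (\<lambda>a b c d e. (a * b * c * d * e) ^ Suc m * (vdm a b c d e)\<^sup>2)"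
proof -
  let ?F = "\<lambda>a b c d e. (a * b * c * d * e) ^ m * (b\<^sup>2 * c\<^sup>2 * d\<^sup>2 * e) * vdm a b c d e"
  let ?H = "\<lambda>a b c d e. (a * b * c * d * e) ^ Suc m * (a * b * (a - b)) * vdm a b c d e"
  have cF: "cluster ?F" unfolding vdm_def by (intro cluster_intros)
  have cH: "cluster ?H" "cluster (\<lambda>a b c d e. ?H b c d e a)" "cluster (\<lambda>a b c d e. ?H c d e a b)"
    "cluster (\<lambda>a b c d e. ?H d e a b c)" "cluster (\<lambda>a b c d e. ?H e a b c d)"
    unfolding vdm_def by (intro cluster_intros)+
  have JH: "J (\<lambda>a b c d e. ?H b c d e a) = J ?H" "J (\<lambda>a b c d e. ?H c d e a b) = J ?H"
    "J (\<lambda>a b c d e. ?H d e a b c) = J ?H" "J (\<lambda>a b c d e. ?H e a b c d) = J ?H"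
    using J_rotate[OF cH(1)] J_rotate[OF cH(2)] J_rotate[OF cH(3)] J_rotate[OF cH(4)] by simp_all
  have 1: "J (weight m 1 1) = J ?F"
  proof (rule J_cong)
    fix a b c d e :: complex
    assume nz: "a \<noteq> 0" and rel: "b * d = 1 + c" "e * b = 1 + a"
    have "a * (1 + inverse a) * (1 + c) = (e * b) * (b * d)" unfolding rel using nz by (simp add: algebra_simps)
    moreover have "weight m 1 1 a b c d e =
      (a * b * c * d * e) ^ m * (c\<^sup>2 * d * vdm a b c d e) * (a * (1 + inverse a) * (1 + c))"
      by (simp add: weight_def)
    ultimately show "weight m 1 1 a b c d e = ?F a b c d e" by (simp add: power2_eq_square)
  qed
  have 2: "2 * J ?F = J (\<lambda>a b c d e. ?H c d e a b)"
  proof -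
    have "2 * J ?F = J ?F + J (refl1 ?F)" using J_refl1[OF cF] by simp
    also have "\<dots> = J (\<lambda>a b c d e. ?F a b c d e + refl1 ?F a b c d e)"
      by (intro J_add[symmetric] cluster_refl1 cF)
    also have "\<dots> = J (\<lambda>a b c d e. ?H c d e a b)"
    proof (rule J_cong)
      fix a b c d e :: complex
      assume rel: "a * c = 1 + b" "d * a = 1 + e"
      \<comment> \<open>As \<open>vdm\<close> changes sign, adding the reflected integrand leaves a
        difference of monomials with the factor \<open>b - e\<close>; this relation supplies the
        \<open>a\<close> that completes another \<open>\<lambda>\<close>.\<close>
      have "b - e = a * (c - d)" using rel by (simp add: algebra_simps)
      moreover have "b\<^sup>2 * c\<^sup>2 * d\<^sup>2 * e - e\<^sup>2 * d\<^sup>2 * c\<^sup>2 * b = b * c\<^sup>2 * d\<^sup>2 * e * (b - e)"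
        by (simp add: power2_eq_square algebra_simps)
      ultimately have X: "b\<^sup>2 * c\<^sup>2 * d\<^sup>2 * e - e\<^sup>2 * d\<^sup>2 * c\<^sup>2 * b = (a * b * c * d * e) * (c * d * (c - d))"
        by (simp only: power2_eq_square mult_ac)
      have p: "a * e * d * c * b = a * b * c * d * e" "c * d * e * a * b = a * b * c * d * e"
        by (simp_all only: mult_ac)
      have "?F a b c d e + refl1 ?F a b c d e =
          (a * b * c * d * e) ^ m * vdm a b c d e * (b\<^sup>2 * c\<^sup>2 * d\<^sup>2 * e - e\<^sup>2 * d\<^sup>2 * c\<^sup>2 * b)"
        unfolding refl1_def vdm_reflect[of a b c d e] p by (simp only: algebra_simps) simp
      then show "?F a b c d e + refl1 ?F a b c d e = ?H c d e a b"
        unfolding X p vdm_rotate(2)[of c d e a b] by (simp only: power_Suc mult_ac)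
    qed
    finally show ?thesis .
  qed
  have 3: "5 * J ?H = J (\<lambda>a b c d e. (a * b * c * d * e) ^ Suc m * (vdm a b c d e)\<^sup>2)"
  proof -
    have "5 * J ?H = J ?H + J (\<lambda>a b c d e. ?H b c d e a) + J (\<lambda>a b c d e. ?H c d e a b) +
        J (\<lambda>a b c d e. ?H d e a b c) + J (\<lambda>a b c d e. ?H e a b c d)"
      unfolding JH by simp
    also have "\<dots> = J (\<lambda>a b c d e. ?H a b c d e + ?H b c d e a + ?H c d e a b + ?H d e a b c + ?H e a b c d)"
      using cH by (simp only: J_add cluster.add)
    also have "\<dots> = J (\<lambda>a b c d e. (a * b * c * d * e) ^ Suc m * (vdm a b c d e)\<^sup>2)"
    proof (rule J_cong)
      fix a b c d e :: complex
      assume "a \<noteq> 0" "b \<noteq> 0" "a * c = 1 + b" "d * a = 1 + e" "e * b = 1 + a"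
      note cyc = cyclic_sum_eq_vdm[OF this]
      have v: "vdm b c d e a = vdm a b c d e" "vdm c d e a b = vdm a b c d e"
        "vdm d e a b c = vdm a b c d e" "vdm e a b c d = vdm a b c d e"
        by (rule vdm_rotate)+
      have p: "b * c * d * e * a = a * b * c * d * e" "c * d * e * a * b = a * b * c * d * e"
        "d * e * a * b * c = a * b * c * d * e" "e * a * b * c * d = a * b * c * d * e"
        by (simp_all add: mult_ac)
      have "?H a b c d e + ?H b c d e a + ?H c d e a b + ?H d e a b c + ?H e a b c d =
          (a * b * c * d * e) ^ Suc m * vdm a b c d e *
          (a * b * (a - b) + b * c * (b - c) + c * d * (c - d) + d * e * (d - e) + e * a * (e - a))"
        unfolding v p by (simp only: distrib_left) (simp only: mult_ac)
      then show "?H a b c d e + ?H b c d e a + ?H c d e a b + ?H d e a b c + ?H e a b c d =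
          (a * b * c * d * e) ^ Suc m * (vdm a b c d e)\<^sup>2"
        unfolding cyc by (simp add: power2_eq_square)
    qed
    finally show ?thesis .
  qed
  have "10 * J (weight m 1 1) = 5 * (2 * J ?F)" unfolding 1 by (simp only: mult.assoc[symmetric]) simp
  then show ?thesis unfolding 2 JH(2) 3 .
qed

section \<open>Evaluation of the integral for \<open>m = 0\<close>\<close>

lemma coeff_mult_small:
  fixes p q :: "'a::comm_semiring_0 poly"
  shows "coeff (p * q) 0 = coeff p 0 * coeff q 0"
    "coeff (p * q) 1 = coeff p 0 * coeff q 1 + coeff p 1 * coeff q 0"
    "coeff (p * q) 2 = coeff p 0 * coeff q 2 + coeff p 1 * coeff q 1 + coeff p 2 * coeff q 0"
  by (simp_all add: coeff_mult numeral_2_eq_2 atMost_Suc algebra_simps)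

lemma coeff_linear_power:
  fixes z :: complex
  shows "coeff ([:1, z:] ^ n) 0 = 1 \<and> coeff ([:1, z:] ^ n) 1 = of_nat n * z \<and>
    coeff ([:1, z:] ^ n) 2 = of_nat n * (of_nat n - 1) / 2 * z\<^sup>2"
proof (induction n)
  case (Suc n)
  have "coeff [:1, z:] 0 = 1" "coeff [:1, z:] 1 = z" "coeff [:1, z:] 2 = 0"
    by (simp_all add: numeral_2_eq_2)
  then show ?case using Suc unfolding power_Suc coeff_mult_small
    by (simp add: field_simps power2_eq_square)
qed (simp add: numeral_2_eq_2)

lemma integral_circle_top:
  fixes R :: "complex poly"
  assumes "\<And>u. u \<noteq> 0 \<Longrightarrow> f u = u\<^sup>2 * poly R (1 / u)" "r \<noteq> 0"
  shows "integral {-pi..pi} (\<lambda>t. f (r * cis t)) = 2 * pi * coeff R 2"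
proof -
  have "((\<lambda>t. (\<lambda>x. poly R x / x\<^sup>2) (1 / (r * cis t))) has_integral 2 * pi * coeff R 2) {-pi..pi}"
    by (rule laurent_circle_integral_inverse) (use assms in auto)
  moreover have "poly R (1 / (r * cis t)) / (1 / (r * cis t))\<^sup>2 = f (r * cis t)" for t
    using assms by (simp add: power_divide)
  ultimately show ?thesis by (simp add: integral_unique)
qed

text \<open>As a function of \<open>u\<close>, \<open>weight 0 h k\<close> is \<open>u\<^sup>2\<close> times a polynomial in \<open>1 / u\<close>, so its constant term
  needs only three coefficients of that polynomial.\<close>

definition top_poly :: "complex \<Rightarrow> complex poly" where
  "top_poly v = [:1, 1 + v:] * [:1, - v:] * [:v, - (1 + v):] * [:-1, v\<^sup>2 - 1:] * [:-1, 0, 1 + v:] * [:1 - v, 1:]"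

lemma coeff_top_poly:
  "coeff (top_poly v) 0 = v - v\<^sup>2"
  "coeff (top_poly v) 1 = - 1 + 3 * v - v\<^sup>2 - v ^ 3 + v ^ 4"
  "coeff (top_poly v) 2 = - 3 + v + v\<^sup>2 - v ^ 3 + v ^ 4"
  unfolding top_poly_def coeff_mult_small
  by (simp_all add: numeral_2_eq_2) (simp_all add: algebra_simps eval_nat_numeral)

lemma chart_weight_0:
  assumes "u \<noteq> 0" "v \<noteq> 0"
  shows "chart (weight 0 h k) u v =
    u\<^sup>2 * poly (smult ((1 + v)\<^sup>2 / v ^ 4) (top_poly v) * ([:1, 1:] ^ h * [:1, 1 + v:] ^ k)) (1 / u)"
proof -
  define x where "x = 1 / u"
  define c d e where "c = (1 + v) / u" and "d = (1 + u + v) / (u * v)" and "e = (1 + u) / v"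
  have c: "c = (1 + v) * x" and d: "d = (1 + x * (1 + v)) / v"
    using assms by (simp_all add: c_def d_def x_def field_simps)
  have f: "u - v = u * (1 + x * (- v))" "v - c = v + x * (- (1 + v))"
    "c - d = (-1 + x * (v\<^sup>2 - 1)) / v" "d - e = u * (-1 + x * (x * (1 + v))) / v"
    "e - u = u * (1 - v + x) / v"
    using assms by (simp_all add: c_def d_def e_def x_def field_simps power2_eq_square)
  \<comment> \<open>Each of \<open>u\<close>, \<open>u - v\<close>, \<open>d - e\<close> and
    \<open>e - u\<close> yields a factor \<open>u\<close>, and \<open>c\<^sup>2\<close> yields
    \<open>x\<^sup>2\<close>.\<close>
  have ux: "u * u * u * u * x * x = u\<^sup>2"
    using assms by (simp add: x_def power2_eq_square)
  let ?Z = "(1 + x * (1 + v)) * (1 + x * (- v)) * (v + x * (- (1 + v))) * (-1 + x * (v\<^sup>2 - 1)) *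
      (-1 + x * (x * (1 + v))) * (1 - v + x)"
  have "chart (weight 0 h k) u v = (u * c\<^sup>2 * d * ((u - v) * (v - c) * (c - d) * (d - e) * (e - u))) *
      (1 + x) ^ h * (1 + c) ^ k"
    by (simp add: chart_def weight_def vdm_def c_def d_def e_def x_def inverse_eq_divide)
  also have "u * c\<^sup>2 * d * ((u - v) * (v - c) * (c - d) * (d - e) * (e - u)) =
      (u * u * u * u * x * x) * ((1 + v)\<^sup>2 / v ^ 4) * ?Z"
    unfolding f unfolding c d using assms by (simp add: power2_eq_square eval_nat_numeral field_simps)
  also have "?Z = poly (top_poly v) x" by (simp only: top_poly_def poly_mult) simp
  finally have "chart (weight 0 h k) u v =
      u\<^sup>2 * ((1 + v)\<^sup>2 / v ^ 4) * poly (top_poly v) x * (1 + x) ^ h * (1 + (1 + v) * x) ^ k"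
    unfolding ux c .
  then show ?thesis by (simp add: x_def[symmetric] mult_ac)
qed

text \<open>The constant term in \<open>u\<close>, multiplied by \<open>v ^ 4\<close>: the first
  three coefficients of \<open>top_poly\<close> convolved with those of the two powers, times
  \<open>(1 + v)\<^sup>2\<close>. Its coefficient of \<open>v ^ 4\<close> is the full constant
  term.\<close>

definition base_poly :: "nat \<Rightarrow> nat \<Rightarrow> complex poly" where
  "base_poly h k = [:1, 2, 1:] *
    ([:0, 1, -1:] * ([:of_nat h * (of_nat h - 1) / 2:] + smult (of_nat h * of_nat k) [:1, 1:] +
        smult (of_nat k * (of_nat k - 1) / 2) [:1, 2, 1:]) +
     [:-1, 3, -1, -1, 1:] * ([:of_nat h:] + smult (of_nat k) [:1, 1:]) + [:-3, 1, 1, -1, 1:])"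

lemma coeff_base_poly:
  "coeff (base_poly h k) 4 =
     - (of_nat h * (of_nat h + 1) / 2 + of_nat h * (of_nat k + 1) + of_nat k * (of_nat h + of_nat k + 1))"
  unfolding base_poly_def by (simp add: eval_nat_numeral) (simp add: field_simps)

lemma coeff_top_poly_mult:
  assumes "v \<noteq> 0"
  shows "coeff (smult ((1 + v)\<^sup>2 / v ^ 4) (top_poly v) * ([:1, 1:] ^ h * [:1, 1 + v:] ^ k)) 2 =
    poly (base_poly h k) v / v ^ 4"
proof -
  have P: "coeff ([:1, 1:] ^ h * [:1, 1 + v:] ^ k) 0 = 1"
    "coeff ([:1, 1:] ^ h * [:1, 1 + v:] ^ k) 1 = of_nat h + of_nat k * (1 + v)"
    "coeff ([:1, 1:] ^ h * [:1, 1 + v:] ^ k) 2 = of_nat h * (of_nat h - 1) / 2 + of_nat h * of_nat k * (1 + v) +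
      of_nat k * (of_nat k - 1) / 2 * (1 + v)\<^sup>2"
    unfolding coeff_mult_small coeff_linear_power[THEN conjunct1]
      coeff_linear_power[THEN conjunct2, THEN conjunct1] coeff_linear_power[THEN conjunct2, THEN conjunct2]
    by simp_all
  have B: "poly (base_poly h k) v = (1 + v)\<^sup>2 * ((v - v\<^sup>2) * (of_nat h * (of_nat h - 1) / 2 +
        of_nat h * of_nat k * (1 + v) + of_nat k * (of_nat k - 1) / 2 * (1 + v)\<^sup>2) +
      (- 1 + 3 * v - v\<^sup>2 - v ^ 3 + v ^ 4) * (of_nat h + of_nat k * (1 + v)) + (- 3 + v + v\<^sup>2 - v ^ 3 + v ^ 4))"
  proof -
    have p: "1 + v * (2 + v) = (1 + v)\<^sup>2" "v * (1 + v * -1) = v - v\<^sup>2"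
      "- 1 + v * (3 + v * (-1 + v * (-1 + v))) = - 1 + 3 * v - v\<^sup>2 - v ^ 3 + v ^ 4"
      "- 3 + v * (1 + v * (1 + v * (-1 + v))) = - 3 + v + v\<^sup>2 - v ^ 3 + v ^ 4"
      by (simp_all add: eval_nat_numeral algebra_simps)
    show ?thesis unfolding base_poly_def p[symmetric]
      by (simp only: poly_mult poly_add poly_smult) simp
  qed
  have gen: "(z / w * t0) * p2 + (z / w * t1) * p1 + z / w * t2 = z * (t0 * p2 + t1 * p1 + t2) / w"
    for z w t0 t1 t2 p1 p2 :: complex
    by (simp add: add_divide_distrib distrib_left mult.assoc)
  show ?thesis
    unfolding coeff_mult_small(3)[of "smult _ _"] P coeff_smult coeff_top_poly B
    by (simp only: mult_1_right gen)
qed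

text \<open>The constant term is taken first in \<open>u\<close>, then in \<open>v\<close>. For
  positive labels the value is negative, so up to sign and scale the integral dominates the constant
  1 from which the count starts.\<close>

lemma J_weight_0:
  "J (weight 0 h k) = - (4 * pi\<^sup>2 *
     (real h * (real h + 1) / 2 + real h * (real k + 1) + real k * (real h + real k + 1)))"
proof -
  let ?r = "of_real phi :: complex"
  let ?B = "\<lambda>v. poly (base_poly h k) v / v ^ 4"
  have r: "?r \<noteq> 0" using phi_gt by simp
  have "integral {-pi..pi} (\<lambda>t. torus (weight 0 h k) t s) = 2 * pi * ?B (?r * cis s)" for s
  proof -
    let ?v = "?r * cis s"
    have v: "?v \<noteq> 0" using r by simp
    have "integral {-pi..pi} (\<lambda>t. (\<lambda>u. chart (weight 0 h k) u ?v) (?r * cis t)) =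
        2 * pi * coeff (smult ((1 + ?v)\<^sup>2 / ?v ^ 4) (top_poly ?v) * ([:1, 1:] ^ h * [:1, 1 + ?v:] ^ k)) 2"
      by (rule integral_circle_top[OF chart_weight_0[OF _ v] r])
    then show ?thesis unfolding coeff_top_poly_mult[OF v] by (simp only: torus_def)
  qed
  then have "box_integral (\<lambda>s t. torus (weight 0 h k) t s) =
      2 * pi * integral {-pi..pi} (\<lambda>s. ?B (?r * cis s))"
    unfolding box_integral_def by (simp only: integral_mult_right)
  also have "integral {-pi..pi} (\<lambda>s. ?B (?r * cis s)) = 2 * pi * coeff (base_poly h k) 4"
    by (intro integral_unique laurent_circle_integral[OF _ r]) simp
  finally show ?thesis
    unfolding J_def box_integral_swap[OF cont2_torus[OF cluster_weight]] coeff_base_poly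
    by (simp add: power2_eq_square algebra_simps)
qed

subsection \<open>Size of the integral\<close>

text \<open>From \<open>1 - cos s = 2 * (sin (s / 2))\<^sup>2\<close> and
  \<open>sin x >= x / 2\<close> for \<open>0 <= x <= 1.6\<close>, a range that covers
  \<open>pi / 2\<close>.\<close>

lemma cos_le_quadratic:
  assumes "s \<in> {-pi..pi}"
  shows "1 - cos s \<ge> s\<^sup>2 / 8"
proof -
  define x where "x = \<bar>s\<bar> / 2"
  have x: "0 \<le> x" "x \<le> 1.6" using assms pi_less_4 pi_approx unfolding x_def by auto
  have "\<bar>sin x - (\<Sum>m<3. sin_coeff m * x ^ m)\<bar> \<le> inverse (fact 3) * \<bar>x\<bar> ^ 3"
    by (rule Maclaurin_sin_bound)
  moreover have "(\<Sum>m<3. sin_coeff m * x ^ m) = x"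
    by (simp add: eval_nat_numeral sin_coeff_def)
  ultimately have "x - x ^ 3 / 6 \<le> sin x" using x by (simp add: fact_numeral abs_if split: if_splits)
  moreover have "x * (x * x) \<le> x * 3"
  proof (intro mult_left_mono)
    have "x * x \<le> 1.6 * 1.6" using x by (intro mult_mono) auto
    then show "x * x \<le> 3" by simp
  qed (use x in simp)
  ultimately have "x / 2 \<le> sin x" by (simp add: power3_eq_cube)
  then have "(x / 2)\<^sup>2 \<le> (sin x)\<^sup>2" using x by (intro power_mono) auto
  moreover have "cos s = cos (2 * x)" by (simp add: x_def)
  then have "1 - cos s = 2 * (sin x)\<^sup>2" by (simp add: cos_double_sin)
  moreover have "x\<^sup>2 = s\<^sup>2 / 4" by (simp add: x_def power_divide)
  ultimately show ?thesis by (simp add: power_divide)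
qed

text \<open>The squared modulus loses \<open>2 * phi * (1 - cos s)\<close>, which is at least
  \<open>(1 + phi)\<^sup>2 * s\<^sup>2 / 20\<close> because
  \<open>(1 + phi)\<^sup>2 <= 5 * phi\<close>; then \<open>1 - z <= exp (- z)\<close>.\<close>

lemma norm_one_plus_le:
  assumes "s \<in> {-pi..pi}"
  shows "norm (1 + of_real phi * cis s) \<le> (1 + phi) * exp (- s\<^sup>2 / 40)"
proof -
  have "(norm (1 + of_real phi * cis s))\<^sup>2 = (1 + phi * cos s)\<^sup>2 + (phi * sin s)\<^sup>2"
    by (simp add: cmod_power2)
  also have "\<dots> = (1 + phi)\<^sup>2 - 2 * phi * (1 - cos s)"
    unfolding power_mult_distrib sin_squared_eq by (simp add: power2_eq_square algebra_simps)
  also have "\<dots> \<le> (1 + phi)\<^sup>2 - 2 * phi * (s\<^sup>2 / 8)"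
    using cos_le_quadratic[OF assms] phi_gt by (intro diff_left_mono mult_left_mono) auto
  also have "\<dots> \<le> (1 + phi)\<^sup>2 - (1 + phi)\<^sup>2 * (s\<^sup>2 / 20)"
  proof -
    have "(1 + phi)\<^sup>2 * (s\<^sup>2 / 20) \<le> (5 * phi) * (s\<^sup>2 / 20)"
    proof (rule mult_right_mono)
      have "(1 + phi)\<^sup>2 = 2 + 3 * phi" using phi_sq by (simp add: power2_eq_square algebra_simps)
      then show "(1 + phi)\<^sup>2 \<le> 5 * phi" using phi_gt by simp
    qed simp
    then show ?thesis by simp
  qed
  also have "\<dots> = (1 + phi)\<^sup>2 * (1 + (- s\<^sup>2 / 20))" by (simp add: algebra_simps)
  also have "\<dots> \<le> (1 + phi)\<^sup>2 * exp (- s\<^sup>2 / 20)"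
    by (intro mult_left_mono exp_ge_add_one_self) auto
  also have "exp (- s\<^sup>2 / 20) = (exp (- s\<^sup>2 / 40))\<^sup>2"
    using exp_double[of "- s\<^sup>2 / 40"] by simp
  finally have "(norm (1 + of_real phi * cis s))\<^sup>2 \<le> ((1 + phi) * exp (- s\<^sup>2 / 40))\<^sup>2"
    by (simp add: power_mult_distrib)
  moreover have "0 \<le> (1 + phi) * exp (- s\<^sup>2 / 40)" using phi_gt by simp
  ultimately show ?thesis by (rule power2_le_imp_le)
qed

text \<open>The product is \<open>(1 + u) * (1 + v) * (1 + u + v) / (u * v)\<close>. The first two
  factors carry the decay, and the triangle inequality suffices for the third. Since
  \<open>1 + phi\<close> and \<open>1 + 2 * phi\<close> are the square and cube of
  \<open>phi\<close>, the maximum is \<open>phi ^ 5\<close>.\<close>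

lemma norm_torus_product_le:
  assumes "s \<in> {-pi..pi}" "t \<in> {-pi..pi}"
  shows "norm (torus (\<lambda>a b c d e. a * b * c * d * e) s t) \<le> phi ^ 5 * exp (- (s\<^sup>2 + t\<^sup>2) / 40)"
proof -
  define u v where uv: "u = of_real phi * cis s" "v = of_real phi * cis t"
  have nz: "u \<noteq> 0" "v \<noteq> 0" using phi_gt by (auto simp: uv)
  have n: "norm u = phi" "norm v = phi" using phi_gt by (auto simp: uv norm_mult)
  have "torus (\<lambda>a b c d e. a * b * c * d * e) s t = (1 + u) * (1 + v) * (1 + u + v) / (u * v)"
    using nz by (simp add: torus_def chart_def flip: uv)
  then have "norm (torus (\<lambda>a b c d e. a * b * c * d * e) s t) =
      norm (1 + u) * norm (1 + v) * norm (1 + u + v) / (phi * phi)"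
    by (simp add: norm_mult norm_divide n)
  also have "\<dots> \<le> ((1 + phi) * exp (- s\<^sup>2 / 40)) * ((1 + phi) * exp (- t\<^sup>2 / 40)) * (1 + phi + phi) / (phi * phi)"
  proof (intro divide_right_mono mult_mono)
    show "norm (1 + u + v) \<le> 1 + phi + phi"
      using norm_triangle_ineq[of "1 + u" v] norm_triangle_ineq[of 1 u] n by simp
  qed (use norm_one_plus_le[OF assms(1)] norm_one_plus_le[OF assms(2)] phi_gt in \<open>auto simp: uv\<close>)
  also have "\<dots> = ((1 + phi) * (1 + phi) * (1 + phi + phi) / (phi * phi)) * exp (- (s\<^sup>2 + t\<^sup>2) / 40)"
    by (simp add: exp_add[symmetric] diff_divide_distrib)
  also have "(1 + phi) * (1 + phi) * (1 + phi + phi) / (phi * phi) = phi ^ 5"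
  proof -
    have "1 + phi = phi * phi" using phi_sq by simp
    moreover have "phi * phi + phi = phi * phi * phi" by (simp only: phi_sq distrib_right mult_1)
    moreover have "(phi * phi) * (phi * phi) * (phi * phi * phi) / (phi * phi) = phi ^ 5"
      using phi_gt by (simp add: eval_nat_numeral)
    ultimately show ?thesis by metis
  qed
  finally show ?thesis .
qed

lemma norm_cis_minus_one_le: "norm (cis s - 1) \<le> \<bar>s\<bar>"
proof -
  have "norm (cis s - 1) = 2 * \<bar>sin (s / 2)\<bar>" using dist_exp_i_1[of s] by (simp add: cis_conv_exp)
  also have "\<dots> \<le> 2 * \<bar>s / 2\<bar>" by (intro mult_left_mono abs_sin_x_le_abs_x) simp
  finally show ?thesis by simp
qed

text \<open>Each coordinate differs from \<open>phi\<close> by at most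
  \<open>4 * (|s| + |t|)\<close>, so two of them differ by at most twice that.\<close>

lemma norm_torus_vdm_le: "norm (torus vdm s t) \<le> (8 * (\<bar>s\<bar> + \<bar>t\<bar>)) ^ 5"
proof -
  define u v where uv: "u = of_real phi * cis s" "v = of_real phi * cis t"
  define f where "f = complex_of_real phi"
  define q where "q = \<bar>s\<bar> + \<bar>t\<bar>"
  have nz: "u \<noteq> 0" "v \<noteq> 0" using phi_gt by (auto simp: uv)
  have n: "norm u = phi" "norm v = phi" "norm f = phi" using phi_gt by (auto simp: uv f_def norm_mult)
  have ff: "f * f = f + 1" unfolding f_def by (simp only: of_real_mult[symmetric] phi_sq) simp
  have q: "0 \<le> q" by (simp add: q_def)
  have du: "norm (u - f) \<le> phi * \<bar>s\<bar>" and dv: "norm (v - f) \<le> phi * \<bar>t\<bar>"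
  proof -
    have "u - f = f * (cis s - 1)" "v - f = f * (cis t - 1)" by (simp_all add: uv f_def algebra_simps)
    then show "norm (u - f) \<le> phi * \<bar>s\<bar>" "norm (v - f) \<le> phi * \<bar>t\<bar>"
      using norm_cis_minus_one_le n phi_gt by (simp_all add: norm_mult)
  qed
  have pq: "phi * \<bar>s\<bar> + phi * \<bar>t\<bar> = phi * q" by (simp add: q_def algebra_simps)
  have a: "norm (u - f) \<le> 4 * q" and b: "norm (v - f) \<le> 4 * q"
  proof -
    have "phi * \<bar>s\<bar> \<le> 4 * \<bar>s\<bar>" "phi * \<bar>t\<bar> \<le> 4 * \<bar>t\<bar>" using phi_lt by (intro mult_right_mono; simp)+
    then show "norm (u - f) \<le> 4 * q" "norm (v - f) \<le> 4 * q" using du dv by (auto simp: q_def)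
  qed
  \<comment> \<open>Covers the third and fifth coordinates, which have the same form; the
    fixed-point equation of \<open>f\<close> removes the constant term.\<close>
  have third: "norm ((1 + y) / x - f) \<le> 4 * q" if "norm x = phi" "norm (x - f) + norm (y - f) \<le> phi * q" for x y
  proof -
    have x: "x \<noteq> 0" using that(1) phi_gt by auto
    have "(1 + y) / x - f = ((y - f) - f * (x - f)) / x"
      using x ff by (simp add: field_simps)
    then have "norm ((1 + y) / x - f) = norm ((y - f) - f * (x - f)) / phi" by (simp add: norm_divide that)
    also have "\<dots> \<le> (norm (y - f) + phi * norm (x - f)) / phi"
      using norm_triangle_ineq4[of "y - f" "f * (x - f)"] n phi_gt
      by (intro divide_right_mono) (auto simp: norm_mult)
    also have "\<dots> \<le> (phi * norm (y - f) + phi * norm (x - f)) / phi"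
      using phi_gt mult_right_mono[of 1 phi "norm (y - f)"] by (intro divide_right_mono) auto
    also have "\<dots> = norm (x - f) + norm (y - f)" using phi_gt by (simp add: field_simps)
    also have "\<dots> \<le> phi * q" by (rule that)
    also have "\<dots> \<le> 4 * q" using phi_lt q by (intro mult_right_mono) auto
    finally show ?thesis .
  qed
  have c: "norm ((1 + v) / u - f) \<le> 4 * q" and e: "norm ((1 + u) / v - f) \<le> 4 * q"
    using du dv pq n by (auto intro!: third)
  have d: "norm ((1 + u + v) / (u * v) - f) \<le> 4 * q"
  proof -
    \<comment> \<open>The fixed-point equation for the fourth coordinate.\<close>
    have fff: "f * (f * f) = 1 + 2 * f" unfolding ff by (simp add: distrib_left ff)
    have "(1 + u + v) / (u * v) - f = (1 + u + v - f * (u * v)) / (u * v)"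
      using nz by (simp add: field_simps)
    also have "1 + u + v - f * (u * v) = (u - f) + (v - f) - f * ((u - f) * v + f * (v - f))"
      using fff by (simp add: algebra_simps)
    finally have "norm ((1 + u + v) / (u * v) - f) =
        norm ((u - f) + (v - f) - f * ((u - f) * v + f * (v - f))) / (phi * phi)"
      by (simp add: norm_divide norm_mult n)
    also have "\<dots> \<le> (norm (u - f) + norm (v - f) + phi * (norm (u - f) * phi + phi * norm (v - f))) / (phi * phi)"
    proof (intro divide_right_mono)
      have "norm ((u - f) * v + f * (v - f)) \<le> norm (u - f) * phi + phi * norm (v - f)"
        using norm_triangle_ineq[of "(u - f) * v" "f * (v - f)"] by (simp add: norm_mult n)
      then have "norm (f * ((u - f) * v + f * (v - f))) \<le> phi * (norm (u - f) * phi + phi * norm (v - f))"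
        using phi_gt by (simp only: norm_mult[of f] n) (intro mult_left_mono; simp)
      then show "norm ((u - f) + (v - f) - f * ((u - f) * v + f * (v - f))) \<le>
          norm (u - f) + norm (v - f) + phi * (norm (u - f) * phi + phi * norm (v - f))"
        using norm_triangle_ineq4[of "(u - f) + (v - f)" "f * ((u - f) * v + f * (v - f))"]
          norm_triangle_ineq[of "u - f" "v - f"] by linarith
    qed simp
    also have "\<dots> = (norm (u - f) + norm (v - f)) * (1 + phi * phi) / (phi * phi)" by (simp add: algebra_simps)
    also have "\<dots> \<le> (phi * q) * (1 + phi * phi) / (phi * phi)"
      using du dv pq phi_gt by (intro divide_right_mono mult_right_mono) auto
    also have "1 + phi * phi = 2 + phi" using phi_sq by simp
    also have "(phi * q) * (2 + phi) / (phi * phi) = q * ((2 + phi) / phi)" using phi_gt by simp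
    also have "\<dots> \<le> q * 4" using q phi_gt by (intro mult_left_mono) (auto simp: field_simps)
    finally show ?thesis by simp
  qed
  have diff: "norm (x - y) \<le> 8 * q" if "norm (x - f) \<le> 4 * q" "norm (y - f) \<le> 4 * q" for x y
    using norm_triangle_ineq4[of "x - f" "y - f"] that by simp
  let ?c = "(1 + v) / u" and ?d = "(1 + u + v) / (u * v)" and ?e = "(1 + u) / v"
  have "norm (torus vdm s t) = norm (u - v) * norm (v - ?c) * norm (?c - ?d) * norm (?d - ?e) * norm (?e - u)"
    by (simp only: torus_def chart_def vdm_def norm_mult flip: uv)
  also have "\<dots> \<le> (8 * q) * (8 * q) * (8 * q) * (8 * q) * (8 * q)"
    using q by (intro mult_mono diff a b c d e mult_nonneg_nonneg norm_ge_zero) auto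
  also have "\<dots> = (8 * q) ^ 5"
  proof -
    have "x * x * x * x * x = x ^ 5" for x :: real by (simp add: eval_nat_numeral)
    then show ?thesis .
  qed
  finally show ?thesis unfolding q_def .
qed

text \<open>A Lorentzian serves as majorant in place of the Gaussian because its antiderivative is
  elementary. Its integral is at most \<open>pi / a\<close>, the right order for
  \<open>a = sqrt n\<close>.\<close>

lemma has_integral_lorentzian:
  fixes a :: real
  assumes "a > 0"
  shows "((\<lambda>t. 1 / (1 + (a * t)\<^sup>2)) has_integral (2 * arctan (a * pi) / a)) {-pi..pi}"
proof -
  have "((\<lambda>t. arctan (a * t) / a) has_vector_derivative 1 / (1 + (a * t)\<^sup>2)) (at t within {-pi..pi})" for t
  proof -
    have "((\<lambda>t. arctan (a * t) / a) has_real_derivative inverse (1 + (a * t)\<^sup>2) * a / a) (at t within {-pi..pi})"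
      by (auto intro!: derivative_eq_intros)
    then show ?thesis
      using assms by (simp add: has_real_derivative_iff_has_vector_derivative inverse_eq_divide)
  qed
  then have "((\<lambda>t. 1 / (1 + (a * t)\<^sup>2)) has_integral (arctan (a * pi) / a - arctan (a * (-pi)) / a)) {-pi..pi}"
    by (intro fundamental_theorem_of_calculus) auto
  then show ?thesis by (simp add: arctan_minus)
qed

text \<open>The seventh power of \<open>1 + x <= 280 * exp (x / 280)\<close>, where
  \<open>280 = 7 * 40\<close> matches the exponent.\<close>

lemma poly_exp_bound:
  fixes x :: real
  assumes "0 \<le> x"
  shows "x ^ 5 * (1 + x)\<^sup>2 * exp (- x / 40) \<le> 280 ^ 7"
proof -
  have "x ^ 5 * (1 + x)\<^sup>2 \<le> (1 + x) ^ 5 * (1 + x)\<^sup>2"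
    using assms by (intro mult_right_mono power_mono) auto
  also have "\<dots> = (1 + x) ^ 7" by (simp flip: power_add)
  also have "\<dots> \<le> (280 * exp (x / 280)) ^ 7"
  proof (rule power_mono)
    have "1 + x \<le> 280 * (1 + x / 280)" by simp
    also have "\<dots> \<le> 280 * exp (x / 280)" by (intro mult_left_mono exp_ge_add_one_self) simp
    finally show "1 + x \<le> 280 * exp (x / 280)" .
  qed (use assms in simp)
  also have "\<dots> = 280 ^ 7 * exp (x / 40)"
    by (simp add: power_mult_distrib flip: exp_of_nat_mult)
  finally have "x ^ 5 * (1 + x)\<^sup>2 \<le> 280 ^ 7 * exp (x / 40)" .
  then have "x ^ 5 * (1 + x)\<^sup>2 * exp (- x / 40) \<le> 280 ^ 7 * exp (x / 40) * exp (- x / 40)"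
    by (rule mult_right_mono) simp
  also have "\<dots> = 280 ^ 7" by (simp only: mult.assoc flip: exp_add) simp
  finally show ?thesis .
qed

text \<open>In terms of \<open>x = n * (s\<^sup>2 + t\<^sup>2)\<close> the squared
  \<open>vdm\<close> gives \<open>x ^ 5 / n ^ 5\<close>; the factor 32 comes from
  \<open>(|s| + |t|)\<^sup>2 <= 2 * (s\<^sup>2 + t\<^sup>2)\<close>. The exponential absorbs
  \<open>x ^ 5\<close> and \<open>(1 + x)\<^sup>2\<close>, and the latter bounds the product of the
  Lorentzian denominators.\<close>

lemma torus_integrand_bound:
  fixes n :: nat
  assumes "n \<ge> 1" "s \<in> {-pi..pi}" "t \<in> {-pi..pi}"
  shows "norm (torus (\<lambda>a b c d e. (a * b * c * d * e) ^ n * (vdm a b c d e)\<^sup>2) s t) \<le>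
    (8 ^ 10 * 32 * 280 ^ 7 * (phi ^ 5) ^ n / real n ^ 5) *
      (1 / (1 + (sqrt n * s)\<^sup>2) * (1 / (1 + (sqrt n * t)\<^sup>2)))"
proof -
  define r where "r = s\<^sup>2 + t\<^sup>2"
  define x where "x = real n * r"
  have r: "0 \<le> r" by (simp add: r_def)
  have x: "0 \<le> x" using r by (simp add: x_def)
  have n: "real n > 0" using assms by simp
  have "norm (torus (\<lambda>a b c d e. (a * b * c * d * e) ^ n * (vdm a b c d e)\<^sup>2) s t) =
      norm (torus (\<lambda>a b c d e. a * b * c * d * e) s t) ^ n * (norm (torus vdm s t))\<^sup>2"
    by (simp only: torus_def chart_def norm_mult norm_power)
  also have "\<dots> \<le> (phi ^ 5 * exp (- r / 40)) ^ n * ((8 * (\<bar>s\<bar> + \<bar>t\<bar>)) ^ 5)\<^sup>2"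
    using phi_gt norm_torus_product_le[OF assms(2,3)] norm_torus_vdm_le[of s t]
    by (intro mult_mono power_mono) (auto simp: r_def)
  also have "(phi ^ 5 * exp (- r / 40)) ^ n = (phi ^ 5) ^ n * exp (- x / 40)"
    by (simp add: power_mult_distrib x_def flip: exp_of_nat_mult)
  also have "((8 * (\<bar>s\<bar> + \<bar>t\<bar>)) ^ 5)\<^sup>2 = 8 ^ 10 * ((\<bar>s\<bar> + \<bar>t\<bar>)\<^sup>2) ^ 5"
    by (simp only: power_mult_distrib flip: power_mult) simp
  also have "(phi ^ 5) ^ n * exp (- x / 40) * (8 ^ 10 * ((\<bar>s\<bar> + \<bar>t\<bar>)\<^sup>2) ^ 5) \<le>
      (phi ^ 5) ^ n * exp (- x / 40) * (8 ^ 10 * (2 * r) ^ 5)"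
  proof -
    have "0 \<le> (\<bar>s\<bar> - \<bar>t\<bar>)\<^sup>2" by simp
    then have "(\<bar>s\<bar> + \<bar>t\<bar>)\<^sup>2 \<le> 2 * r" by (simp add: r_def power2_eq_square algebra_simps)
    then show ?thesis using phi_gt by (intro mult_left_mono power_mono) auto
  qed
  also have "\<dots> = (8 ^ 10 * 32 * (phi ^ 5) ^ n / real n ^ 5) * (x ^ 5 * exp (- x / 40))"
    using n by (simp add: x_def power_mult_distrib)
  also have "\<dots> \<le> (8 ^ 10 * 32 * (phi ^ 5) ^ n / real n ^ 5) *
      (280 ^ 7 * (1 / (1 + (sqrt n * s)\<^sup>2) * (1 / (1 + (sqrt n * t)\<^sup>2))))"
  proof (intro mult_left_mono)
    let ?D = "(1 + (sqrt n * s)\<^sup>2) * (1 + (sqrt n * t)\<^sup>2)"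
    have D: "?D = 1 + x + (real n * s\<^sup>2) * (real n * t\<^sup>2)"
      by (simp add: x_def r_def power_mult_distrib algebra_simps)
    have "?D \<le> (1 + x)\<^sup>2"
    proof -
      have "(real n * s\<^sup>2) * (real n * t\<^sup>2) \<le> x * x"
        using n by (intro mult_mono) (auto simp: x_def r_def)
      then show ?thesis unfolding D using x by (simp add: power2_eq_square algebra_simps)
    qed
    moreover have Dpos: "0 < ?D" by (intro mult_pos_pos add_pos_nonneg) auto
    ultimately have "x ^ 5 * exp (- x / 40) * ?D \<le> x ^ 5 * exp (- x / 40) * (1 + x)\<^sup>2"
      using x by (intro mult_left_mono) auto
    also have "\<dots> \<le> 280 ^ 7" using poly_exp_bound[OF x] by (simp add: mult_ac)
    finally show "x ^ 5 * exp (- x / 40) \<le> 280 ^ 7 * (1 / (1 + (sqrt n * s)\<^sup>2) * (1 / (1 + (sqrt n * t)\<^sup>2)))"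
      using Dpos by (simp add: field_simps)
  qed (use phi_gt in simp)
  finally show ?thesis by (simp add: mult_ac)
qed

lemma norm_J_le:
  assumes "n \<ge> 1"
  shows "norm (J (\<lambda>a b c d e. (a * b * c * d * e) ^ n * (vdm a b c d e)\<^sup>2)) \<le>
    8 ^ 10 * 32 * 280 ^ 7 * pi\<^sup>2 * ((phi ^ 5) ^ n / real n ^ 6)"
proof -
  let ?K = "8 ^ 10 * 32 * 280 ^ 7 * (phi ^ 5) ^ n / real n ^ 5"
  let ?I = "2 * arctan (sqrt n * pi) / sqrt n"
  have n: "0 < sqrt n" using assms by simp
  have "cluster (\<lambda>a b c d e. (a * b * c * d * e) ^ n * (vdm a b c d e)\<^sup>2)"
    unfolding vdm_def by (intro cluster_intros)
  then have "norm (J (\<lambda>a b c d e. (a * b * c * d * e) ^ n * (vdm a b c d e)\<^sup>2)) \<le> ?K * ?I\<^sup>2"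
    unfolding J_def by (intro norm_box_integral_le[OF cont2_torus _ has_integral_lorentzian[OF n]]
        torus_integrand_bound[OF assms])
  also have "\<dots> \<le> ?K * (pi / sqrt n)\<^sup>2"
  proof (intro mult_left_mono power_mono divide_right_mono)
    show "2 * arctan (sqrt n * pi) \<le> pi" using arctan_ubound[of "sqrt n * pi"] by simp
  qed (use n phi_gt in auto)
  also have "\<dots> = 8 ^ 10 * 32 * 280 ^ 7 * pi\<^sup>2 * ((phi ^ 5) ^ n / real n ^ 6)"
    using assms by (simp add: power_divide field_simps eval_nat_numeral)
  finally show ?thesis .
qed

subsection \<open>The upper bound\<close>

text \<open>Sign and normalisation turn the case \<open>m = 0\<close> into a quadratic polynomial in
  the labels that is at least 1 on positive ones.\<close>

definition majorant :: "nat \<Rightarrow> nat \<Rightarrow> nat \<Rightarrow> real" where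
  "majorant m h k = - Re (J (weight m h k)) / (4 * pi\<^sup>2)"

lemma succ_rule_majorant: "succ_rule (majorant m) h k = majorant (Suc m) h k"
proof -
  have eq: "Re (J (weight (Suc m) h k)) =
      (\<Sum>i = 1..h. Re (J (weight m i (Suc k)))) + (\<Sum>j = 1..k. Re (J (weight m (Suc (h + k) - j) j)))"
    unfolding J_weight_step[symmetric] by (simp only: plus_complex.sel Re_sum)
  show ?thesis
    unfolding succ_rule_def majorant_def eq sum_divide_distrib[symmetric] sum_negf
      add_divide_distrib[symmetric] by simp
qed

text \<open>The rule evaluates its function at positive labels only, so a comparison there is
  enough.\<close>

lemma succ_rule_mono:
  assumes "\<And>h k. h \<ge> 1 \<Longrightarrow> k \<ge> 1 \<Longrightarrow> f h k \<le> g h k"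
  shows "succ_rule f h k \<le> succ_rule g h k"
  unfolding succ_rule_def by (intro add_mono sum_mono assms) auto

lemma majorant_0_ge_1:
  assumes "h \<ge> 1" "k \<ge> 1"
  shows "1 \<le> majorant 0 h k"
proof -
  have "majorant 0 h k = real h * (real h + 1) / 2 + real h * (real k + 1) + real k * (real h + real k + 1)"
    unfolding majorant_def J_weight_0 by simp
  moreover have "1 * 1 \<le> real h * (real k + 1)" using assms by (intro mult_mono) auto
  moreover have "0 \<le> real h * (real h + 1) / 2" "0 \<le> real k * (real h + real k + 1)" by simp_all
  ultimately show ?thesis by linarith
qed

text \<open>The majorant obeys the rule exactly and starts above 1; monotonicity carries the
  comparison through all generations.\<close>

lemma funpow_succ_rule_le:
  assumes "h \<ge> 1" "k \<ge> 1"
  shows "(succ_rule ^^ m) (\<lambda>_ _. 1) h k \<le> majorant m h k"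
  using assms
proof (induction m arbitrary: h k)
  case 0
  then show ?case using majorant_0_ge_1 by simp
next
  case (Suc m)
  have "succ_rule ((succ_rule ^^ m) (\<lambda>_ _. 1)) h k \<le> succ_rule (majorant m) h k"
    by (rule succ_rule_mono) (rule Suc.IH)
  then show ?case by (simp add: succ_rule_majorant)
qed

lemma card_plane_perms_bound:
  assumes "n \<ge> 1"
  shows "real (card (plane_perms n)) \<le> 8 ^ 10 * 280 ^ 7 * ((phi ^ 5) ^ n / real n ^ 6)"
proof -
  obtain m where m: "n = Suc m" using assms by (cases n) auto
  let ?B = "8 ^ 10 * 280 ^ 7 * ((phi ^ 5) ^ n / real n ^ 6)"
  have "0 \<le> ?B" using phi_gt by simp
  have "norm (10 * J (weight m 1 1)) \<le> 32 * pi\<^sup>2 * ?B"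
    unfolding J_weight_1_1 m[symmetric] using norm_J_le[OF assms] by (simp add: mult_ac)
  \<comment> \<open>The factor 10 from the symmetrisation absorbs the 32, since
    \<open>32 / 10 <= 4\<close>.\<close>
  then have "\<bar>Re (J (weight m 1 1))\<bar> \<le> 4 * pi\<^sup>2 * ?B"
    using abs_Re_le_cmod[of "J (weight m 1 1)"] mult_nonneg_nonneg[OF _ \<open>0 \<le> ?B\<close>, of "pi\<^sup>2"]
    by (simp only: norm_mult) simp
  then have "majorant m 1 1 \<le> ?B"
    unfolding majorant_def by (subst pos_divide_le_eq) (simp_all add: mult_ac)
  moreover have "real (card (plane_perms n)) \<le> majorant m 1 1"
    using card_plane_perms_le[of m] funpow_succ_rule_le[of 1 1 m] m by simp
  ultimately show ?thesis by linarith
qed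

theorem theorem17:
  fixes C :: real
  assumes "C = (11 + 5 * sqrt 5) / 2"
  shows "C \<le> 11.091 \<and>
    (\<exists>K::real. K > 0 \<and>
      (\<forall>n::nat. n \<ge> 1 \<longrightarrow>
        (\<exists>R. complete_representations n R \<and>
             real (card R) \<le> K * (fact n * (C ^ n / real n ^ 6)))))"
proof
  have "sqrt 5 \<le> 2.2364" by (rule real_le_lsqrt) (simp_all add: power2_eq_square)
  then show "C \<le> 11.091" unfolding assms by simp
  \<comment> \<open>Reduction by the quadratic equation of \<open>phi\<close> gives
    \<open>phi ^ 5 = 5 * phi + 3\<close>.\<close>
  have C: "phi ^ 5 = C"
  proof -
    have "phi * (phi * phi) = 2 * phi + 1" unfolding phi_sq by (simp add: distrib_left phi_sq)
    then have "phi ^ 5 = (phi + 1) * (2 * phi + 1)" by (simp add: eval_nat_numeral phi_sq flip: mult.assoc)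
    also have "\<dots> = 2 * (phi * phi) + 3 * phi + 1" by (simp add: algebra_simps)
    also have "\<dots> = 5 * phi + 3" by (simp only: phi_sq) simp
    also have "\<dots> = C" by (simp add: phi_def assms field_simps)
    finally show ?thesis .
  qed
  let ?K = "8 ^ 10 * 280 ^ 7 :: real"
  have "\<exists>R. complete_representations n R \<and> real (card R) \<le> ?K * (fact n * (C ^ n / real n ^ 6))"
    if n: "n \<ge> 1" for n :: nat
  proof -
    obtain R where R: "complete_representations n R" "card R \<le> fact n * card (plane_perms n)"
      using exists_complete_representations by blast
    have "real (card R) \<le> real (fact n * card (plane_perms n))" using R(2) by (rule of_nat_mono)
    also have "\<dots> = fact n * real (card (plane_perms n))" by simp
    also have "\<dots> \<le> fact n * (?K * (C ^ n / real n ^ 6))"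
      using card_plane_perms_bound[OF n] unfolding C by (intro mult_left_mono) auto
    finally have "real (card R) \<le> ?K * (fact n * (C ^ n / real n ^ 6))" by (simp only: mult_ac)
    with R(1) show ?thesis by blast
  qed
  then show "\<exists>K::real. K > 0 \<and> (\<forall>n::nat. n \<ge> 1 \<longrightarrow>
      (\<exists>R. complete_representations n R \<and> real (card R) \<le> K * (fact n * (C ^ n / real n ^ 6))))"
    by (intro exI[of _ ?K]) simp
qed

end
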